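(* Let $\mathbb{K}_1,\mathbb{K}_2\in\{\mathbb{R},\mathbb{C},\mathbb{H},\mathbb{O}\}$, with $\nu_i=\dim_{\mathbb{R}}\mathbb{K}_i$. Then, as real Lie algebras, $$L_2(\mathbb{K}_1,\mathbb{K}_2)\cong\mathfrak{so}(\mathbb{K}_1\,\dot{+}\,\mathbb{K}_2),$$ and, if $\mathbb{K}_2\in\{\mathbb{C},\mathbb{H},\mathbb{O}\}$ and $\tilde{\mathbb{K}}_2$ is the split form of $\mathbb{K}_2$, $$L_2(\mathbb{K}_1,\tilde{\mathbb{K}}_2)\cong\mathfrak{so}\bigl(\nu_1+\tfrac12\nu_2,\ \tfrac12\nu_2\bigr).$$
   Context: $\dot{+}$ denotes direct sum of vector spaces. A real composition algebra $\mathbb{K}$ is a unital (not necessarily associative) real algebra with a non-degenerate quadratic form $x\mapsto|x|^2$ satisfying $|xy|^2=|x|^2|y|^2$. $\mathbb{R}\subset\mathbb{K}$ is the span of the identity, $\mathbb{K}'$ its orthogonal complement; conjugation $x\mapsto\bar x$ is $+1$ on $\mathbb{R}$ and $-1$ on $\mathbb{K}'$; $\mathrm{Re}$ is the projection on $\mathbb{R}$; $\langle x,y\rangle=\mathrm{Re}(x\bar y)$. $\mathbb{R},\mathbb{C},\mathbb{H},\mathbb{O}$ are the positive definite composition algebras; $\tilde{\mathbb{C}},\tilde{\mathbb{H}},\tilde{\mathbb{O}}$ are the split forms of $\mathbb{C},\mathbb{H},\mathbb{O}$ (same dimension, quadratic form of neutral signature). $\mathfrak{so}(V)$ is the Lie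 algebra of linear maps of $V$ antisymmetric with respect to the given non-degenerate form; on $\mathbb{K}_1\,\dot{+}\,\mathbb{K}_2$ the form is $|x_1+x_2|^2=|x_1|^2+|x_2|^2$. $\mathfrak{so}(s,t)$ is the pseudo-orthogonal Lie algebra of a real quadratic form with $s$ squares of one sign and $t$ of the other. $H_2(\mathbb{K})$ is the Jordan algebra of hermitian $2\times2$ matrices over $\mathbb{K}$ with product $A\cdot B=AB+BA$; $H_2'(\mathbb{K})$ is its traceless subspace; $\mathrm{Der}$ denotes the derivation algebra. $L_2(\mathbb{K}_1,\mathbb{K}_2)=\mathrm{Der}\,H_2(\mathbb{K}_1)\,\dot{+}\,H_2'(\mathbb{K}_1)\otimes\mathbb{K}_2'\,\dot{+}\,\mathfrak{so}(\mathbb{K}_2')$ is the Lie algebra in which $\mathrm{Der}\,H_2(\mathbb{K}_1)$ and $\mathfrak{so}(\mathbb{K}_2')$ are Lie subalgebras and $[D,A\otimes x]=D(A)\otimes x$, $[E,A\otimes x]=A\otimes E(x)$, $[D,E]=0$, $[A\otimes x,B\otimes y]=\langle A,B\rangle S_{x,y}-\langle x,y\rangle[R_A,R_B]$, for $D\in\mathrm{Der}\,H_2(\mathbb{K}_1)$, $E\in\mathfrak{so}(\mathbb{K}_2')$, $A,B\in H_2'(\mathbb{K}_1)$, $x,y\in\mathbb{K}_2'$. Here $\langle A,B\rangle=\mathrm{Re}\,\mathrm{tr}(A\cdot B)$, $R_A$ is multiplication by $A$ in the Jordan algebra $H_2(\mathbb{K}_1)$ (so $[R_A,R_B]\in\mathrm{Der}\,H_2(\mathbb{K}_1)$),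 and $S_{x,y}(z)=\langle x,z\rangle y-\langle y,z\rangle x$. The same definition is used with $\tilde{\mathbb{K}}_2$ in place of $\mathbb{K}_2$. *)

theory Defs
  imports "HOL-Analysis.Analysis" "HOL-Library.Function_Algebras"
begin

instantiation "fun" :: (type, real_vector) real_vector
begin

definition scaleR_fun_def: "c *\<^sub>R f = (\<lambda>x. c *\<^sub>R f x)"

instance
  by standard (auto simp: scaleR_fun_def fun_eq_iff algebra_simps)

end

definition linear_on :: "'v::real_vector set \<Rightarrow> ('v \<Rightarrow> 'w::real_vector) \<Rightarrow> bool" where
  "linear_on V f \<longleftrightarrow>
     (\<forall>x\<in>V. \<forall>y\<in>V. f (x + y) = f x + f y) \<and> (\<forall>c. \<forall>x\<in>V. f (c *\<^sub>R x) = c *\<^sub>R f x)"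

definition bilinear_on ::
    "'v::real_vector set \<Rightarrow> 'w::real_vector set \<Rightarrow> ('v \<Rightarrow> 'w \<Rightarrow> 'u::real_vector) \<Rightarrow> bool" where
  "bilinear_on V W f \<longleftrightarrow>
     (\<forall>v\<in>V. linear_on W (f v)) \<and> (\<forall>w\<in>W. linear_on V (\<lambda>v. f v w))"

text \<open>Extending maps by 0 outside the subspace \<open>V\<close> makes a linear map \<open>V \<rightarrow> V\<close> correspond to
  exactly one function on the ambient type, and makes the linear structure and the composition
  of these maps agree with those of functions.\<close>

definition endo :: "'v::real_vector set \<Rightarrow> ('v \<Rightarrow> 'v) set" where
  "endo V = {T. linear_on V T \<and> (\<forall>x\<in>V. T x \<in> V) \<and> (\<forall>x. x \<notin> V \<longrightarrow> T x = 0)}"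

definition on_space :: "'v::real_vector set \<Rightarrow> ('v \<Rightarrow> 'v) \<Rightarrow> 'v \<Rightarrow> 'v" where
  "on_space V f = (\<lambda>x. if x \<in> V then f x else 0)"

definition commutator :: "('v::real_vector \<Rightarrow> 'v) \<Rightarrow> ('v \<Rightarrow> 'v) \<Rightarrow> 'v \<Rightarrow> 'v" where
  "commutator S T = (\<lambda>x. S (T x) - T (S x))"

record 'g lie =
  carrier :: "'g set"
  bracket :: "'g \<Rightarrow> 'g \<Rightarrow> 'g"

definition lie_algebra :: "'g::real_vector lie \<Rightarrow> bool" where
  "lie_algebra L \<longleftrightarrow>
     subspace (carrier L) \<and>
     (\<forall>x\<in>carrier L. \<forall>y\<in>carrier L. bracket L x y \<in> carrier L) \<and>
     bilinear_on (carrier L) (carrier L) (bracket L) \<and>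
     (\<forall>x\<in>carrier L. bracket L x x = 0) \<and>
     (\<forall>x\<in>carrier L. \<forall>y\<in>carrier L. \<forall>z\<in>carrier L.
        bracket L x (bracket L y z) + bracket L y (bracket L z x) + bracket L z (bracket L x y) = 0)"

definition lie_iso :: "'g::real_vector lie \<Rightarrow> 'h::real_vector lie \<Rightarrow> bool"  (infix "\<cong>\<^sub>L" 50) where
  "L \<cong>\<^sub>L M \<longleftrightarrow> lie_algebra L \<and> lie_algebra M \<and>
     (\<exists>\<phi>. linear_on (carrier L) \<phi> \<and> bij_betw \<phi> (carrier L) (carrier M) \<and>
        (\<forall>x\<in>carrier L. \<forall>y\<in>carrier L. \<phi> (bracket L x y) = bracket M (\<phi> x) (\<phi> y)))"

definition polar :: "('v::real_vector \<Rightarrow> real) \<Rightarrow> 'v \<Rightarrow> 'v \<Rightarrow> real" where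
  "polar q x y = (q (x + y) - q x - q y) / 2"

definition quadratic_form :: "('v::real_vector \<Rightarrow> real) \<Rightarrow> bool" where
  "quadratic_form q \<longleftrightarrow> bilinear (polar q) \<and> (\<forall>c x. q (c *\<^sub>R x) = c\<^sup>2 * q x)"

definition nondegenerate :: "('v::real_vector \<Rightarrow> real) \<Rightarrow> bool" where
  "nondegenerate q \<longleftrightarrow> (\<forall>x. (\<forall>y. polar q x y = 0) \<longrightarrow> x = 0)"

definition positive_definite :: "('v::real_vector \<Rightarrow> real) \<Rightarrow> bool" where
  "positive_definite q \<longleftrightarrow> (\<forall>x. x \<noteq> 0 \<longrightarrow> q x > 0)"

definition has_signature :: "('v::real_vector \<Rightarrow> real) \<Rightarrow> nat \<Rightarrow> nat \<Rightarrow> bool" where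
  "has_signature q s t \<longleftrightarrow>
     (\<exists>P N. finite P \<and> finite N \<and> P \<inter> N = {} \<and> card P = s \<and> card N = t \<and>
        independent (P \<union> N) \<and> span (P \<union> N) = UNIV \<and>
        (\<forall>u\<in>P \<union> N. \<forall>v\<in>P \<union> N. u \<noteq> v \<longrightarrow> polar q u v = 0) \<and>
        (\<forall>u\<in>P. q u = 1) \<and> (\<forall>u\<in>N. q u = -1))"

definition so :: "'v::real_vector set \<Rightarrow> ('v \<Rightarrow> real) \<Rightarrow> ('v \<Rightarrow> 'v) lie" where
  "so V q =
     \<lparr>carrier = {T \<in> endo V. \<forall>x\<in>V. \<forall>y\<in>V. polar q (T x) y = - polar q x (T y)},
      bracket = commutator\<rparr>"

text \<open>\<open>\<real>\<^sup>n\<close> is realised as the real sequences supported on \<open>{..<n}\<close>.\<close>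

definition so_pq :: "nat \<Rightarrow> nat \<Rightarrow> ((nat \<Rightarrow> real) \<Rightarrow> (nat \<Rightarrow> real)) lie" where
  "so_pq s t =
     so {x. \<forall>i\<ge>s + t. x i = 0} (\<lambda>x. (\<Sum>i<s. (x i)\<^sup>2) - (\<Sum>i\<in>{s..<s + t}. (x i)\<^sup>2))"

record 'k calg =
  cmult :: "'k \<Rightarrow> 'k \<Rightarrow> 'k"
  cone :: 'k
  cnorm :: "'k \<Rightarrow> real"  \<comment> \<open>the quadratic form \<open>x \<mapsto> |x|\<^sup>2\<close>\<close>

definition composition_algebra :: "'k::real_vector calg \<Rightarrow> bool" where
  "composition_algebra K \<longleftrightarrow>
     bilinear (cmult K) \<and>
     cone K \<noteq> 0 \<and> (\<forall>x. cmult K (cone K) x = x \<and> cmult K x (cone K) = x) \<and>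
     quadratic_form (cnorm K) \<and> nondegenerate (cnorm K) \<and>
     (\<forall>x y. cnorm K (cmult K x y) = cnorm K x * cnorm K y)"

definition pure :: "'k::real_vector calg \<Rightarrow> 'k set" where
  "pure K = {x. polar (cnorm K) x (cone K) = 0}"

definition re :: "'k::real_vector calg \<Rightarrow> 'k \<Rightarrow> real" where
  "re K x = (THE r. x - r *\<^sub>R cone K \<in> pure K)"

definition cconj :: "'k::real_vector calg \<Rightarrow> 'k \<Rightarrow> 'k" where
  "cconj K x = re K x *\<^sub>R cone K - (x - re K x *\<^sub>R cone K)"

definition cinner :: "'k::real_vector calg \<Rightarrow> 'k \<Rightarrow> 'k \<Rightarrow> real" where
  "cinner K x y = re K (cmult K x (cconj K y))"

definition calg_iso :: "'k::real_vector calg \<Rightarrow> 'l::real_vector calg \<Rightarrow> bool" where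
  "calg_iso K L \<longleftrightarrow>
     (\<exists>f. linear f \<and> bij f \<and> f (cone K) = cone L \<and>
        (\<forall>x y. f (cmult K x y) = cmult L (f x) (f y)) \<and> (\<forall>x. cnorm L (f x) = cnorm K x))"

text \<open>Cayley-Dickson doubling \<open>K + K l\<close> with \<open>l\<^sup>2 = \<epsilon>\<close>.\<close>

definition doubling :: "real \<Rightarrow> 'k::real_vector calg \<Rightarrow> ('k \<times> 'k) calg" where
  "doubling \<epsilon> K =
     \<lparr>cmult = (\<lambda>(a, b) (c, d). (cmult K a c + \<epsilon> *\<^sub>R cmult K (cconj K d) b,
                               cmult K d a + cmult K b (cconj K c))),
      cone = (cone K, 0),
      cnorm = (\<lambda>(a, b). cnorm K a - \<epsilon> * cnorm K b)\<rparr>"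

definition real_alg :: "real calg" where
  "real_alg = \<lparr>cmult = (*), cone = 1, cnorm = (\<lambda>x. x\<^sup>2)\<rparr>"

definition complex_alg :: "complex calg" where
  "complex_alg = \<lparr>cmult = (*), cone = 1, cnorm = (\<lambda>z. (cmod z)\<^sup>2)\<rparr>"

definition quaternion_alg :: "(complex \<times> complex) calg" where
  "quaternion_alg = doubling (-1) complex_alg"

definition octonion_alg :: "((complex \<times> complex) \<times> (complex \<times> complex)) calg" where
  "octonion_alg = doubling (-1) quaternion_alg"

definition split_form_of :: "'l::real_vector calg \<Rightarrow> 'k::real_vector calg \<Rightarrow> bool" where
  "split_form_of Ks K \<longleftrightarrow>
     composition_algebra Ks \<and> dim (UNIV :: 'l set) = dim (UNIV :: 'k set) \<and>
     (\<exists>p. has_signature (cnorm Ks) p p)"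

definition sum_form :: "'k::real_vector calg \<Rightarrow> 'l::real_vector calg \<Rightarrow> 'k \<times> 'l \<Rightarrow> real" where
  "sum_form K L = (\<lambda>(x, y). cnorm K x + cnorm L y)"

definition mat_mult :: "'k::real_vector calg \<Rightarrow> 'k^2^2 \<Rightarrow> 'k^2^2 \<Rightarrow> 'k^2^2" where
  "mat_mult K A B = (\<chi> i j. \<Sum>k\<in>UNIV. cmult K (A $ i $ k) (B $ k $ j))"

definition jordan :: "'k::real_vector calg \<Rightarrow> 'k^2^2 \<Rightarrow> 'k^2^2 \<Rightarrow> 'k^2^2" where
  "jordan K A B = mat_mult K A B + mat_mult K B A"

definition tr :: "'k::real_vector^2^2 \<Rightarrow> 'k" where
  "tr A = (\<Sum>i\<in>UNIV. A $ i $ i)"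

definition H2 :: "'k::real_vector calg \<Rightarrow> ('k^2^2) set" where
  "H2 K = {A. \<forall>i j. A $ i $ j = cconj K (A $ j $ i)}"

definition H2' :: "'k::real_vector calg \<Rightarrow> ('k^2^2) set" where
  "H2' K = {A \<in> H2 K. tr A = 0}"

definition Der_H2 :: "'k::real_vector calg \<Rightarrow> ('k^2^2 \<Rightarrow> 'k^2^2) set" where
  "Der_H2 K = {D \<in> endo (H2 K). \<forall>A\<in>H2 K. \<forall>B\<in>H2 K.
     D (jordan K A B) = jordan K (D A) B + jordan K A (D B)}"

definition R_op :: "'k::real_vector calg \<Rightarrow> 'k^2^2 \<Rightarrow> 'k^2^2 \<Rightarrow> 'k^2^2" where
  "R_op K A = on_space (H2 K) (jordan K A)"

definition mat_inner :: "'k::real_vector calg \<Rightarrow> 'k^2^2 \<Rightarrow> 'k^2^2 \<Rightarrow> real" where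
  "mat_inner K A B = re K (tr (jordan K A B))"

definition S_op :: "'k::real_vector calg \<Rightarrow> 'k \<Rightarrow> 'k \<Rightarrow> 'k \<Rightarrow> 'k" where
  "S_op K x y = on_space (pure K) (\<lambda>z. cinner K x z *\<^sub>R y - cinner K y z *\<^sub>R x)"

text \<open>The pure tensor \<open>v \<otimes> w\<close> is represented by evaluation of bilinear forms at \<open>(v, w)\<close>.
  Bilinear forms separate the elements of an algebraic tensor product, and every bilinear form on
  a pair of subspaces extends to the whole spaces, so that the span of the pure tensors with
  \<open>v \<in> V\<close> and \<open>w \<in> W\<close> is the tensor product of \<open>V\<close> and \<open>W\<close>.\<close>

type_synonym ('v, 'w) tensor = "('v \<Rightarrow> 'w \<Rightarrow> real) \<Rightarrow> real"

definition tensor :: "'v::real_vector \<Rightarrow> 'w::real_vector \<Rightarrow> ('v, 'w) tensor"  (infix "\<otimes>" 75) where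
  "v \<otimes> w = (\<lambda>\<beta>. if bilinear \<beta> then \<beta> v w else 0)"

definition tensor_space ::
    "'v::real_vector set \<Rightarrow> 'w::real_vector set \<Rightarrow> ('v, 'w) tensor set" where
  "tensor_space V W = span {v \<otimes> w | v w. v \<in> V \<and> w \<in> W}"

text \<open>The linear map on the tensor product of \<open>V\<close> and \<open>W\<close> induced by a bilinear map \<open>f\<close> on
  \<open>V \<times> W\<close>; only its values on \<open>tensor_space V W\<close> are determined.\<close>

definition tensor_lift ::
    "'v::real_vector set \<Rightarrow> 'w::real_vector set \<Rightarrow> ('v \<Rightarrow> 'w \<Rightarrow> 'u::real_vector) \<Rightarrow>
     ('v, 'w) tensor \<Rightarrow> 'u" where
  "tensor_lift V W f = (SOME g. linear g \<and> (\<forall>v\<in>V. \<forall>w\<in>W. g (v \<otimes> w) = f v w))"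

text \<open>A triple \<open>(D, t, E)\<close> stands for \<open>D + t + E\<close> in
  \<open>Der H\<^sub>2(K\<^sub>1) + H\<^sub>2'(K\<^sub>1) \<otimes> K\<^sub>2' + so(K\<^sub>2')\<close>.\<close>

type_synonym ('k, 'l) L2_vec =
  "('k^2^2 \<Rightarrow> 'k^2^2) \<times> ('k^2^2, 'l) tensor \<times> ('l \<Rightarrow> 'l)"

definition L2_act ::
    "'k::real_vector calg \<Rightarrow> 'l::real_vector calg \<Rightarrow> ('k^2^2 \<Rightarrow> 'k^2^2) \<Rightarrow> ('l \<Rightarrow> 'l) \<Rightarrow>
     ('k^2^2, 'l) tensor \<Rightarrow> ('k^2^2, 'l) tensor" where
  "L2_act K1 K2 D E = tensor_lift (H2' K1) (pure K2) (\<lambda>A x. D A \<otimes> x + A \<otimes> E x)"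

definition L2_tensor_bracket_Der ::
    "'k::real_vector calg \<Rightarrow> 'l::real_vector calg \<Rightarrow>
     ('k^2^2, 'l) tensor \<Rightarrow> ('k^2^2, 'l) tensor \<Rightarrow> 'k^2^2 \<Rightarrow> 'k^2^2" where
  "L2_tensor_bracket_Der K1 K2 t u =
     tensor_lift (H2' K1) (pure K2) (\<lambda>A x.
       tensor_lift (H2' K1) (pure K2) (\<lambda>B y.
         - (cinner K2 x y *\<^sub>R commutator (R_op K1 A) (R_op K1 B))) u) t"

definition L2_tensor_bracket_so ::
    "'k::real_vector calg \<Rightarrow> 'l::real_vector calg \<Rightarrow>
     ('k^2^2, 'l) tensor \<Rightarrow> ('k^2^2, 'l) tensor \<Rightarrow> 'l \<Rightarrow> 'l" where
  "L2_tensor_bracket_so K1 K2 t u =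
     tensor_lift (H2' K1) (pure K2) (\<lambda>A x.
       tensor_lift (H2' K1) (pure K2) (\<lambda>B y.
         mat_inner K1 A B *\<^sub>R S_op K2 x y) u) t"

definition L2 ::
    "'k::real_vector calg \<Rightarrow> 'l::real_vector calg \<Rightarrow> ('k, 'l) L2_vec lie" where
  "L2 K1 K2 =
     \<lparr>carrier = Der_H2 K1 \<times> tensor_space (H2' K1) (pure K2) \<times> carrier (so (pure K2) (cnorm K2)),
      bracket = (\<lambda>(D, t, E) (D', t', E').
        (commutator D D' + L2_tensor_bracket_Der K1 K2 t t',
         L2_act K1 K2 D E t' - L2_act K1 K2 D' E' t,
         commutator E E' + L2_tensor_bracket_so K1 K2 t t'))\<rparr>"

lemma polar_commute: "polar q x y = polar q y x"
  by (simp add: polar_def add.commute)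

context
  fixes K :: "'k::real_vector calg"
  assumes K: "composition_algebra K"
begin

lemma
  shows calg_bilinear: "bilinear (cmult K)"
    and calg_polar_bilinear: "bilinear (polar (cnorm K))"
    and calg_one [simp]: "cmult K (cone K) x = x" "cmult K x (cone K) = x"
    and calg_quadratic_form: "quadratic_form (cnorm K)"
    and calg_norm_scale: "cnorm K (c *\<^sub>R x) = c\<^sup>2 * cnorm K x"
    and calg_norm_mult: "cnorm K (cmult K x y) = cnorm K x * cnorm K y"
    and calg_one_nonzero: "cone K \<noteq> 0"
  using K unfolding composition_algebra_def quadratic_form_def by blast+

lemma calg_nondegenerate: "(\<And>y. polar (cnorm K) x y = 0) \<Longrightarrow> x = 0"
  using K unfolding composition_algebra_def nondegenerate_def by blast

lemmas calg_mult_simps =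
  bilinear_ladd[OF calg_bilinear] bilinear_radd[OF calg_bilinear]
  bilinear_lmul[OF calg_bilinear] bilinear_rmul[OF calg_bilinear]
  bilinear_lneg[OF calg_bilinear] bilinear_rneg[OF calg_bilinear]
  bilinear_lsub[OF calg_bilinear] bilinear_rsub[OF calg_bilinear]
  bilinear_lzero[OF calg_bilinear] bilinear_rzero[OF calg_bilinear]

lemmas calg_polar_simps =
  bilinear_ladd[OF calg_polar_bilinear] bilinear_radd[OF calg_polar_bilinear]
  bilinear_lmul[OF calg_polar_bilinear] bilinear_rmul[OF calg_polar_bilinear]
  bilinear_lneg[OF calg_polar_bilinear] bilinear_rneg[OF calg_polar_bilinear]
  bilinear_lsub[OF calg_polar_bilinear] bilinear_rsub[OF calg_polar_bilinear]
  bilinear_lzero[OF calg_polar_bilinear] bilinear_rzero[OF calg_polar_bilinear]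

lemma calg_norm_add: "cnorm K (x + y) = cnorm K x + cnorm K y + 2 * polar (cnorm K) x y"
  by (simp add: polar_def field_simps)

lemma calg_polar_self: "polar (cnorm K) x x = cnorm K x"
proof -
  have "cnorm K (x + x) = 4 * cnorm K x"
    using calg_norm_scale[of 2 x] by (simp add: scaleR_2)
  then show ?thesis by (simp add: polar_def)
qed

lemma calg_norm_one: "cnorm K (cone K) = 1"
proof (rule ccontr)
  assume 1: "cnorm K (cone K) \<noteq> 1"
  have "cnorm K (cone K) = cnorm K (cone K) * cnorm K (cone K)"
    using calg_norm_mult[of "cone K" "cone K"] by simp
  with 1 have "cnorm K (cone K) = 0" by simp
  then have "cnorm K x = 0" for x using calg_norm_mult[of "cone K" x] by simp
  then have "polar (cnorm K) (cone K) y = 0" for y by (simp add: polar_def)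
  then show False using calg_nondegenerate calg_one_nonzero by blast
qed

lemma calg_pure_subspace: "subspace (pure K)"
  by (auto simp: subspace_def pure_def calg_polar_simps)

lemma calg_re: "re K x = polar (cnorm K) x (cone K)"
  unfolding re_def pure_def
  by (rule the_equality) (auto simp: calg_polar_simps calg_polar_self calg_norm_one)

lemma calg_cconj: "cconj K x = (2 * polar (cnorm K) x (cone K)) *\<^sub>R cone K - x"
  unfolding cconj_def calg_re by (simp add: scaleR_2[symmetric])

lemma calg_cconj_cconj [simp]: "cconj K (cconj K x) = x"
  by (simp add: calg_cconj calg_polar_simps calg_polar_self calg_norm_one)

lemma calg_cconj_add: "cconj K (x + y) = cconj K x + cconj K y"
  by (simp add: calg_cconj calg_polar_simps algebra_simps)

lemma calg_cconj_scale: "cconj K (c *\<^sub>R x) = c *\<^sub>R cconj K x"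
  by (simp add: calg_cconj calg_polar_simps algebra_simps)

lemma calg_cconj_norm: "cnorm K (cconj K x) = cnorm K x"
proof -
  have "cnorm K (cconj K x) = polar (cnorm K) (cconj K x) (cconj K x)"
    by (simp add: calg_polar_self)
  also have "\<dots> = polar (cnorm K) x x"
    unfolding calg_cconj
    by (simp add: calg_polar_simps calg_polar_self[of "cone K"] calg_norm_one algebra_simps
        polar_commute[of _ "cone K" x])
  finally show ?thesis by (simp add: calg_polar_self)
qed

lemma calg_polar_mult_right:
  "polar (cnorm K) (cmult K x z) (cmult K y z) = polar (cnorm K) x y * cnorm K z"
  using calg_norm_mult[of "x + y" z]
  by (simp add: calg_mult_simps calg_norm_add calg_norm_mult algebra_simps)

lemma calg_polar_mult_left:
  "polar (cnorm K) (cmult K z x) (cmult K z y) = cnorm K z * polar (cnorm K) x y"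
  using calg_norm_mult[of z "x + y"]
  by (simp add: calg_mult_simps calg_norm_add calg_norm_mult algebra_simps)

lemma calg_adjoint_left:
  "polar (cnorm K) x (cmult K z y) = polar (cnorm K) (cmult K (cconj K z) x) y"
proof -
  have "polar (cnorm K) (cmult K (z + cone K) x) (cmult K (z + cone K) y) =
        cnorm K (z + cone K) * polar (cnorm K) x y"
    by (rule calg_polar_mult_left)
  then have "polar (cnorm K) (cmult K z x) y + polar (cnorm K) x (cmult K z y) =
        2 * polar (cnorm K) z (cone K) * polar (cnorm K) x y"
    by (simp add: calg_mult_simps calg_polar_simps calg_norm_add calg_norm_one
        calg_polar_mult_left algebra_simps)
  then show ?thesis by (simp add: calg_cconj calg_mult_simps calg_polar_simps)
qed

lemma calg_adjoint_right:
  "polar (cnorm K) x (cmult K y z) = polar (cnorm K) (cmult K x (cconj K z)) y"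
proof -
  have "polar (cnorm K) (cmult K x (z + cone K)) (cmult K y (z + cone K)) =
        polar (cnorm K) x y * cnorm K (z + cone K)"
    by (rule calg_polar_mult_right)
  then have "polar (cnorm K) (cmult K x z) y + polar (cnorm K) x (cmult K y z) =
        2 * polar (cnorm K) z (cone K) * polar (cnorm K) x y"
    by (simp add: calg_mult_simps calg_polar_simps calg_norm_add calg_norm_one
        calg_polar_mult_right algebra_simps)
  then show ?thesis by (simp add: calg_cconj calg_mult_simps calg_polar_simps)
qed

lemma calg_cinner: "cinner K x y = polar (cnorm K) x y"
  using calg_adjoint_right[of x "cone K" y] by (simp add: cinner_def calg_re)

lemma calg_polar_cconj: "polar (cnorm K) (cconj K x) y = polar (cnorm K) x (cconj K y)"
  unfolding calg_cconj
  by (simp add: calg_polar_simps polar_commute[of _ "cone K" y])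

lemma calg_cconj_mult: "cconj K (cmult K x y) = cmult K (cconj K y) (cconj K x)"
proof -
  have "polar (cnorm K) (cconj K (cmult K x y) - cmult K (cconj K y) (cconj K x)) z = 0" for z
  proof -
    have "polar (cnorm K) (cconj K (cmult K x y)) z = polar (cnorm K) (cconj K z) (cmult K x y)"
      by (simp add: calg_polar_cconj polar_commute)
    also have "\<dots> = polar (cnorm K) y (cmult K (cconj K x) (cconj K z))"
      by (metis calg_adjoint_left polar_commute)
    also have "\<dots> = polar (cnorm K) (cmult K (cconj K y) (cconj K x)) z"
      by (metis calg_adjoint_left calg_adjoint_right calg_cconj_cconj polar_commute)
    finally show ?thesis by (simp add: calg_polar_simps)
  qed
  then have "cconj K (cmult K x y) - cmult K (cconj K y) (cconj K x) = 0"
    by (rule calg_nondegenerate)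
  then show ?thesis by simp
qed

lemma composition_algebra_doubling:
  assumes assoc: "\<And>x y z. cmult K (cmult K x y) z = cmult K x (cmult K y z)"
    and \<epsilon>: "\<epsilon> = 1 \<or> \<epsilon> = -1"
  shows "composition_algebra (doubling \<epsilon> K)"
proof -
  let ?P = "polar (cnorm K)" and ?L = "doubling \<epsilon> K"
  have P: "polar (cnorm ?L) = (\<lambda>x y. ?P (fst x) (fst y) - \<epsilon> * ?P (snd x) (snd y))"
    by (auto simp: fun_eq_iff polar_def doubling_def field_simps)
  have m: "cmult ?L = (\<lambda>x y. (cmult K (fst x) (fst y) + \<epsilon> *\<^sub>R cmult K (cconj K (snd y)) (snd x),
      cmult K (snd y) (fst x) + cmult K (snd x) (cconj K (fst y))))"
    by (auto simp: fun_eq_iff doubling_def)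
  have 1: "cone ?L = (cone K, 0)" by (simp add: doubling_def)
  have n: "cnorm ?L = (\<lambda>x. cnorm K (fst x) - \<epsilon> * cnorm K (snd x))"
    by (auto simp: fun_eq_iff doubling_def)
  have "bilinear (cmult ?L)"
    unfolding bilinear_def m
    by (intro conjI allI linearI)
      (simp_all add: calg_mult_simps calg_cconj_add calg_cconj_scale algebra_simps)
  moreover have "cone ?L \<noteq> 0" by (simp add: 1 calg_one_nonzero zero_prod_def)
  moreover have "cmult ?L (cone ?L) x = x \<and> cmult ?L x (cone ?L) = x" for x
  proof -
    have "cconj K 0 = 0" using calg_cconj_scale[of 0 0] by simp
    moreover have "cconj K (cone K) = cone K"
      by (simp add: calg_cconj calg_polar_self calg_norm_one scaleR_2)
    ultimately show ?thesis by (simp add: 1 m calg_mult_simps)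
  qed
  moreover have "quadratic_form (cnorm ?L)"
    unfolding quadratic_form_def P bilinear_def
    by (auto intro!: linearI simp: calg_polar_simps n calg_norm_scale algebra_simps)
  moreover have "nondegenerate (cnorm ?L)"
    unfolding nondegenerate_def P
  proof (intro allI impI)
    fix x :: "'k \<times> 'k"
    assume x: "\<forall>y. ?P (fst x) (fst y) - \<epsilon> * ?P (snd x) (snd y) = 0"
    have "?P (fst x) y = 0" for y
      using x[rule_format, of "(y, 0)"] by (simp add: calg_polar_simps)
    moreover have "?P (snd x) y = 0" for y
      using x[rule_format, of "(0, y)"] \<epsilon> by (auto simp: calg_polar_simps)
    ultimately show "x = 0" using calg_nondegenerate by (simp add: prod_eq_iff)
  qed
  moreover have "cnorm ?L (cmult ?L x y) = cnorm ?L x * cnorm ?L y" for x y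
  proof -
    obtain a b c d where xy: "x = (a, b)" "y = (c, d)" by (cases x, cases y)
    have "?P (cmult K a c) (cmult K (cconj K d) b) = ?P (cmult K (cmult K d a) c) b"
      using calg_adjoint_left[of "cmult K a c" "cconj K d" b] by (simp add: assoc)
    also have "\<dots> = ?P (cmult K d a) (cmult K b (cconj K c))"
      using calg_adjoint_right[of "cmult K d a" b "cconj K c"] by simp
    finally have e: "?P (cmult K a c) (cmult K (cconj K d) b) =
      ?P (cmult K d a) (cmult K b (cconj K c))" .
    show ?thesis
      using \<epsilon> by (auto simp: xy n m calg_norm_add calg_norm_scale calg_norm_mult calg_cconj_norm
          calg_polar_simps e algebra_simps)
  qed
  ultimately show ?thesis unfolding composition_algebra_def by blast
qed

end

lemma has_signature_doubling:
  fixes K :: "'k::real_vector calg"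
  assumes K: "quadratic_form (cnorm K)" and s: "has_signature (cnorm K) n 0"
  shows "has_signature (cnorm (doubling (-1) K)) (n + n) 0"
    and "has_signature (cnorm (doubling 1 K)) n n"
proof -
  obtain P where P: "finite P" "card P = n" "independent P" "span P = UNIV"
    "\<And>u v. u \<in> P \<Longrightarrow> v \<in> P \<Longrightarrow> u \<noteq> v \<Longrightarrow> polar (cnorm K) u v = 0"
    "\<And>u. u \<in> P \<Longrightarrow> cnorm K u = 1"
    using s unfolding has_signature_def by (auto simp: card_eq_0_iff)
  have bl: "bilinear (polar (cnorm K))" using K by (simp add: quadratic_form_def)
  have n0: "cnorm K 0 = 0" using K unfolding quadratic_form_def
    by (metis scaleR_zero_left mult_zero_left power_zero_numeral)
  have "0 \<notin> P" using P(6) n0 by fastforce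
  define A where "A = (\<lambda>u::'k. (u, 0::'k)) ` P"
  define B where "B = (\<lambda>u::'k. (0::'k, u)) ` P"
  have fin: "finite A" "finite B" using P(1) by (auto simp: A_def B_def)
  have disj: "A \<inter> B = {}" using \<open>0 \<notin> P\<close> by (auto simp: A_def B_def)
  have card: "card A = n" "card B = n" using P(2)
    by (auto simp: A_def B_def card_image inj_on_def)
  have sA: "span A = (\<lambda>u. (u, 0)) ` UNIV" 
    unfolding A_def using linear_span_image[of "\<lambda>u::'k. (u, 0::'k)" P] P(4)
    by (simp add: linear_iff)
  have sB: "span B = (\<lambda>u. (0, u)) ` UNIV" 
    unfolding B_def using linear_span_image[of "\<lambda>u::'k. (0::'k, u)" P] P(4)
    by (simp add: linear_iff)
  have sp: "span (A \<union> B) = UNIV"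
  proof -
    have "(x, y) \<in> span (A \<union> B)" for x y :: 'k
    proof -
      have "(x, 0) \<in> span (A \<union> B)" "(0, y) \<in> span (A \<union> B)"
        using sA sB span_mono[of A "A \<union> B"] span_mono[of B "A \<union> B"] by auto
      then show ?thesis using span_add by fastforce
    qed
    then show ?thesis by auto
  qed
  have pol: "polar (cnorm (doubling \<epsilon> K)) x y =
      polar (cnorm K) (fst x) (fst y) - \<epsilon> * polar (cnorm K) (snd x) (snd y)" for \<epsilon> x y
    by (cases x; cases y) (simp add: polar_def doubling_def field_simps)
  have P5: "polar (cnorm K) u v \<noteq> 0 \<Longrightarrow> u \<in> P \<Longrightarrow> v \<in> P \<Longrightarrow> u = v" for u v
    using P(5) by blast
  have orth: "polar (cnorm (doubling \<epsilon> K)) u v = 0"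
    if "u \<in> A \<union> B" "v \<in> A \<union> B" "u \<noteq> v" for u v \<epsilon>
    using that by (auto simp: A_def B_def pol bilinear_lzero[OF bl] bilinear_rzero[OF bl] dest: P5)
  have nA: "cnorm (doubling \<epsilon> K) u = 1" if "u \<in> A" for u \<epsilon>
    using that P(6) n0 by (auto simp: A_def doubling_def)
  have nB: "cnorm (doubling \<epsilon> K) u = - \<epsilon>" if "u \<in> B" for u \<epsilon>
    using that P(6) n0 by (auto simp: B_def doubling_def)
  have ind: "independent (A \<union> B)"
  proof
    assume "dependent (A \<union> B)"
    then obtain a where a: "a \<in> A \<union> B" "a \<in> span (A \<union> B - {a})"
      unfolding dependent_def by blast
    let ?f = "\<lambda>x. polar (cnorm (doubling (-1) K)) x a"
    have lin: "linear ?f"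
      by (rule linearI) (simp_all add: pol bilinear_ladd[OF bl] bilinear_lmul[OF bl] algebra_simps)
    have "?f a = 0"
    proof (rule linear_eq_0_on_span[OF lin _ a(2)])
      fix x assume "x \<in> A \<union> B - {a}"
      then show "?f x = 0" using orth a(1) by blast
    qed
    moreover have "?f a = 1"
    proof -
      have "polar (cnorm K) u u = 1" if "u \<in> P" for u
      proof -
        have "cnorm K (u + u) = 4 * cnorm K u"
          using K[unfolded quadratic_form_def, THEN conjunct2, rule_format, of 2 u]
          by (simp add: scaleR_2)
        then show ?thesis using P(6)[OF that] by (simp add: polar_def)
      qed
      then show ?thesis using a(1)
        by (auto simp: A_def B_def pol bilinear_lzero[OF bl] bilinear_rzero[OF bl])
    qed
    ultimately show False by simp
  qed
  show "has_signature (cnorm (doubling (-1) K)) (n + n) 0"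
    unfolding has_signature_def
    by (rule exI[of _ "A \<union> B"], rule exI[of _ "{}"])
      (use fin disj card sp orth nA nB ind in \<open>auto simp: card_Un_disjoint\<close>)
  show "has_signature (cnorm (doubling 1 K)) n n"
    unfolding has_signature_def
    by (rule exI[of _ A], rule exI[of _ B]) (use fin disj card sp orth nA nB ind in auto)
qed

lemma has_signature_dim:
  assumes "has_signature (q :: 'v::real_vector \<Rightarrow> real) s t"
  shows "dim (UNIV :: 'v set) = s + t"
proof -
  obtain P N where PN: "finite P" "finite N" "P \<inter> N = {}" "card P = s" "card N = t"
    "independent (P \<union> N)" "span (P \<union> N) = (UNIV :: 'v set)"
    using assms unfolding has_signature_def by (elim exE conjE) (rule that)
  have "dim (UNIV :: 'v set) = card (P \<union> N)"
    by (rule dim_eq_card) (use PN(6,7) in simp_all)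
  also have "\<dots> = s + t"
    using card_Un_disjoint[OF PN(1-3)] PN(4,5) by simp
  finally show ?thesis .
qed

lemma real_alg: "composition_algebra real_alg" "has_signature (cnorm real_alg) 1 0"
proof -
  have P: "polar (\<lambda>x::real. x\<^sup>2) = (\<lambda>x y. x * y)"
    by (auto simp: polar_def fun_eq_iff power2_eq_square algebra_simps)
  show "composition_algebra real_alg"
    by (auto simp: composition_algebra_def real_alg_def quadratic_form_def nondegenerate_def P
        bilinear_def power_mult_distrib intro!: linearI simp: algebra_simps)
  have "x \<in> span {1}" for x :: real
    using span_scale[OF span_base[of 1 "{1::real}"], of x] by simp
  then show "has_signature (cnorm real_alg) 1 0"
    unfolding has_signature_def
    by (intro exI[of _ "{1}"] exI[of _ "{}"]) (auto simp: real_alg_def)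
qed

lemma complex_alg: "composition_algebra complex_alg" "has_signature (cnorm complex_alg) 2 0"
proof -
  have P: "polar (\<lambda>z::complex. (cmod z)\<^sup>2) = (\<lambda>x y. Re x * Re y + Im x * Im y)"
    by (simp add: polar_def fun_eq_iff cmod_power2 power2_sum)
  have "z = 0" if "\<forall>y. Re z * Re y + Im z * Im y = 0" for z
    using that[rule_format, of 1] that[rule_format, of \<i>] by (simp add: complex_eq_iff)
  then show "composition_algebra complex_alg"
    by (auto simp: composition_algebra_def complex_alg_def quadratic_form_def nondegenerate_def P
        bilinear_def power_mult_distrib norm_mult intro!: linearI simp: algebra_simps)
  have "x \<in> span {1, \<i>}" for x
  proof -
    have "x = Re x *\<^sub>R 1 + Im x *\<^sub>R \<i>" by (simp add: complex_eq_iff)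
    then show ?thesis by (metis span_add span_base span_scale insertI1 insertI2)
  qed
  moreover have "independent {1, \<i>}"
    by (auto simp: independent_insert span_singleton complex_eq_iff)
  ultimately show "has_signature (cnorm complex_alg) 2 0"
    unfolding has_signature_def
    by (intro exI[of _ "{1, \<i>}"] exI[of _ "{}"]) (auto simp: complex_alg_def P complex_eq_iff)
qed

lemma quaternion_alg:
  "composition_algebra quaternion_alg" "has_signature (cnorm quaternion_alg) 4 0"
  "cmult quaternion_alg (cmult quaternion_alg x y) z =
   cmult quaternion_alg x (cmult quaternion_alg y z)"
proof -
  show c: "composition_algebra quaternion_alg" unfolding quaternion_alg_def
    by (rule composition_algebra_doubling[OF complex_alg(1)]) (simp_all add: complex_alg_def mult.assoc)
  show "has_signature (cnorm quaternion_alg) 4 0"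
    using has_signature_doubling(1)[OF calg_quadratic_form[OF complex_alg(1)] complex_alg(2)]
    by (simp add: quaternion_alg_def)
  have cc: "cconj complex_alg w = cnj w" for w
  proof -
    have "polar (\<lambda>z. (cmod z)\<^sup>2) w 1 = Re w"
      by (simp add: polar_def cmod_power2 power2_sum)
    then show ?thesis
      by (simp add: calg_cconj[OF complex_alg(1)]) (simp add: complex_alg_def complex_eq_iff)
  qed
  have cm: "cmult quaternion_alg (a, b) (c, d) = (a * c - cnj d * b, d * a + b * cnj c)" for a b c d
    by (simp add: quaternion_alg_def doubling_def cc) (simp add: complex_alg_def)
  show "cmult quaternion_alg (cmult quaternion_alg x y) z =
     cmult quaternion_alg x (cmult quaternion_alg y z)"
    by (cases x; cases y; cases z) (simp add: cm algebra_simps)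
qed

lemma octonion_alg:
  "composition_algebra octonion_alg" "has_signature (cnorm octonion_alg) 8 0"
proof -
  show "composition_algebra octonion_alg" unfolding octonion_alg_def
    by (rule composition_algebra_doubling[OF quaternion_alg(1)]) (auto simp: quaternion_alg(3))
  show "has_signature (cnorm octonion_alg) 8 0"
    using has_signature_doubling(1)[OF calg_quadratic_form[OF quaternion_alg(1)] quaternion_alg(2)]
    by (simp add: octonion_alg_def)
qed

lemma positive_definite_doubling:
  assumes K: "composition_algebra K" and p: "positive_definite (cnorm K)"
  shows "positive_definite (cnorm (doubling (-1) K))"
proof -
  have "cnorm K 0 = 0" using calg_norm_scale[OF K, of 0 0] by simp
  with p have "cnorm K x \<ge> 0" "cnorm K x > 0 \<longleftrightarrow> x \<noteq> 0" for x
    by (cases "x = 0"; auto simp: positive_definite_def less_imp_le)+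
  then show ?thesis
    by (auto simp: positive_definite_def doubling_def zero_prod_def intro: add_pos_nonneg add_nonneg_pos)
qed

lemma positive_definite_standard:
  "positive_definite (cnorm real_alg)" "positive_definite (cnorm complex_alg)"
  "positive_definite (cnorm quaternion_alg)" "positive_definite (cnorm octonion_alg)"
proof -
  show "positive_definite (cnorm real_alg)" and c: "positive_definite (cnorm complex_alg)"
    by (auto simp: positive_definite_def real_alg_def complex_alg_def)
  show q: "positive_definite (cnorm quaternion_alg)"
    unfolding quaternion_alg_def by (rule positive_definite_doubling[OF complex_alg(1) c])
  show "positive_definite (cnorm octonion_alg)"
    unfolding octonion_alg_def by (rule positive_definite_doubling[OF quaternion_alg(1) q])
qed

lemma split_forms:
  "split_form_of (doubling 1 real_alg) complex_alg"
  "split_form_of (doubling 1 complex_alg) quaternion_alg"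
  "split_form_of (doubling 1 quaternion_alg) octonion_alg"
proof -
  have q: "quadratic_form (cnorm real_alg)" "quadratic_form (cnorm complex_alg)"
    "quadratic_form (cnorm quaternion_alg)"
    by (rule calg_quadratic_form, rule real_alg complex_alg quaternion_alg)+
  note s = has_signature_doubling(2)[OF q(1) real_alg(2)]
    has_signature_doubling(2)[OF q(2) complex_alg(2)]
    has_signature_doubling(2)[OF q(3) quaternion_alg(2)]
  have c: "composition_algebra (doubling 1 real_alg)" "composition_algebra (doubling 1 complex_alg)"
    "composition_algebra (doubling 1 quaternion_alg)"
    by (rule composition_algebra_doubling[OF real_alg(1)]
        composition_algebra_doubling[OF complex_alg(1)]
        composition_algebra_doubling[OF quaternion_alg(1)];
        simp add: real_alg_def complex_alg_def quaternion_alg(3) mult.assoc)+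
  show "split_form_of (doubling 1 real_alg) complex_alg"
    using c(1) s(1) has_signature_dim[OF s(1)] has_signature_dim[OF complex_alg(2)]
    unfolding split_form_of_def by auto
  show "split_form_of (doubling 1 complex_alg) quaternion_alg"
    using c(2) s(2) has_signature_dim[OF s(2)] has_signature_dim[OF quaternion_alg(2)]
    unfolding split_form_of_def by auto
  show "split_form_of (doubling 1 quaternion_alg) octonion_alg"
    using c(3) s(3) has_signature_dim[OF s(3)] has_signature_dim[OF octonion_alg(2)]
    unfolding split_form_of_def by auto
qed

lemma tensor_lift_exists:
  fixes f :: "'v::real_vector \<Rightarrow> 'w::real_vector \<Rightarrow> 'u::real_vector"
  assumes V: "subspace V" and W: "subspace W" and f: "bilinear_on V W f"
  shows "\<exists>g. linear g \<and> (\<forall>v\<in>V. \<forall>w\<in>W. g (v \<otimes> w) = f v w)"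
proof -
  obtain B where B: "B \<subseteq> V" "independent B" "V \<subseteq> span B"
    by (rule basis_exists)
  obtain C where C: "C \<subseteq> W" "independent C" "W \<subseteq> span C"
    by (rule basis_exists)
  have sB: "span B = V" using B V by (simp add: span_minimal subset_antisym)
  have sC: "span C = W" using C W by (simp add: span_minimal subset_antisym)
  have dual: "\<exists>\<beta>. bilinear \<beta> \<and> (\<forall>b\<in>B. \<forall>c\<in>C. \<beta> b c = (if b = b0 \<and> c = c0 then 1 else 0 :: real))" for b0 c0
  proof -
    obtain p where p: "linear p" "\<forall>x\<in>B. p x = (if x = b0 then 1 else 0 :: real)"
      using linear_independent_extend[OF B(2), of "\<lambda>x. if x = b0 then 1 else 0 :: real"] by blast
    obtain q where q: "linear q" "\<forall>x\<in>C. q x = (if x = c0 then 1 else 0 :: real)"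
      using linear_independent_extend[OF C(2), of "\<lambda>x. if x = c0 then 1 else 0 :: real"] by blast
    have "bilinear (\<lambda>x y. p x * q y)" unfolding bilinear_def
      by (intro conjI allI linearI)
        (simp_all add: linear_add[OF p(1)] linear_add[OF q(1)] linear_scale[OF p(1)]
          linear_scale[OF q(1)] distrib_left distrib_right)
    then show ?thesis using p(2) q(2) by (intro exI[of _ "\<lambda>x y. p x * q y"]) simp
  qed
  define T where "T = (\<lambda>(b, c). (b::'v) \<otimes> (c::'w))"
  obtain \<beta> where bl: "\<And>b0 c0. bilinear (\<beta> b0 c0)"
    and bv: "\<And>b0 c0 b c. b \<in> B \<Longrightarrow> c \<in> C \<Longrightarrow> \<beta> b0 c0 b c = (if b = b0 \<and> c = c0 then 1 else 0 :: real)"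
    using dual by metis
  have Tv: "T z (\<beta> b0 c0) = (if z = (b0, c0) then 1 else 0)" if "z \<in> B \<times> C" for z b0 c0
    using that bl bv by (auto simp: T_def tensor_def split: if_splits)
  have injT: "inj_on T (B \<times> C)"
  proof (rule inj_onI)
    fix z z' assume z: "z \<in> B \<times> C" "z' \<in> B \<times> C" "T z = T z'"
    have "T z (\<beta> (fst z) (snd z)) = 1" using Tv[OF z(1)] by simp
    then have "T z' (\<beta> (fst z) (snd z)) = 1" using z(3) by simp
    then show "z = z'" using Tv[OF z(2)] by (auto split: if_splits)
  qed
  have eval: "linear (\<lambda>t :: ('v, 'w) tensor. t b)" for b
    by (auto simp: linear_iff scaleR_fun_def)
  have indT: "independent (T ` (B \<times> C))"
  proof
    assume "dependent (T ` (B \<times> C))"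
    then obtain a where a: "a \<in> T ` (B \<times> C)" "a \<in> span (T ` (B \<times> C) - {a})"
      unfolding dependent_def by blast
    then obtain b0 c0 where z: "b0 \<in> B" "c0 \<in> C" "a = T (b0, c0)" by auto
    have "t (\<beta> b0 c0) = 0" if "t \<in> span (T ` (B \<times> C) - {a})" for t
    proof -
      have "t' (\<beta> b0 c0) = 0" if t': "t' \<in> T ` (B \<times> C) - {a}" for t'
        using t' z Tv by auto
      show ?thesis by (rule linear_eq_0_on_span[OF eval _ that]) fact
    qed
    then have "a (\<beta> b0 c0) = 0" using a by blast
    then show False using Tv[of "(b0, c0)" b0 c0] z by simp
  qed
  obtain g where g: "linear g"
    "\<And>t. t \<in> T ` (B \<times> C) \<Longrightarrow> g t = case_prod f (inv_into (B \<times> C) T t)"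
    using linear_independent_extend[OF indT, of "\<lambda>t. case_prod f (inv_into (B \<times> C) T t)"] by blast
  have gT: "g (b \<otimes> c) = f b c" if "b \<in> B" "c \<in> C" for b c
  proof -
    have bc: "(b, c) \<in> B \<times> C" using that by simp
    have "g (T (b, c)) = f b c"
      unfolding g(2)[OF imageI[OF bc]] inv_into_f_f[OF injT bc] by simp
    then show ?thesis by (simp add: T_def)
  qed
  have addr: "v \<otimes> (w + w') = v \<otimes> w + v \<otimes> w'" "(v + v') \<otimes> w = v \<otimes> w + v' \<otimes> w"
       "v \<otimes> (k *\<^sub>R w) = k *\<^sub>R (v \<otimes> w)" "(k *\<^sub>R v) \<otimes> w = k *\<^sub>R (v \<otimes> w)"
    for v v' :: 'v and w w' :: 'w and k
    by (auto simp: tensor_def fun_eq_iff scaleR_fun_def bilinear_ladd bilinear_radd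
        bilinear_lmul bilinear_rmul)
  have g1: "g (b \<otimes> w) = f b w" if b: "b \<in> B" and w: "w \<in> W" for b w
  proof -
    have lf: "linear_on W (f b)" using f b B(1) by (auto simp: bilinear_on_def)
    have "w \<in> W \<and> g (b \<otimes> w) = f b w" if "w \<in> span C" for w
      using that
    proof (induction rule: span_induct_alt)
      case base
      have "f b 0 = 0 *\<^sub>R f b 0" using lf W unfolding linear_on_def
        by (metis scaleR_zero_left subspace_0)
      moreover have "b \<otimes> (0::'w) = 0" using addr(3)[of b 0 0] by simp
      ultimately show ?case
        using subspace_0[OF W] linear_0[OF g(1)] by (metis scaleR_zero_left)
    next
      case (step c x y)
      from step(1) have xW: "x \<in> W" using C by blast
      have y: "y \<in> W" "g (b \<otimes> y) = f b y" using step by auto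
      have "g (b \<otimes> (c *\<^sub>R x + y)) = c *\<^sub>R g (b \<otimes> x) + g (b \<otimes> y)"
        by (simp only: addr linear_add[OF g(1)] linear_scale[OF g(1)])
      also have "\<dots> = f b (c *\<^sub>R x) + f b y"
        using lf xW gT[OF b step(1)] y(2) by (simp add: linear_on_def)
      also have "\<dots> = f b (c *\<^sub>R x + y)"
        using lf xW y(1) W by (simp add: linear_on_def subspace_scale)
      finally show ?case using xW y(1) W by (simp add: subspace_add subspace_scale)
    qed
    then show ?thesis using w sC by blast
  qed
  have "v \<in> V \<and> g (v \<otimes> w) = f v w" if w: "w \<in> W" and "v \<in> span B" for v w
    using that(2)
  proof (induction rule: span_induct_alt)
    case base
    have lf: "linear_on V (\<lambda>v. f v w)" using f w by (auto simp: bilinear_on_def)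
    have "f 0 w = 0 *\<^sub>R f 0 w" using lf V unfolding linear_on_def
      by (metis scaleR_zero_left subspace_0)
    moreover have "(0::'v) \<otimes> w = 0" using addr(4)[of 0 0 w] by simp
    ultimately show ?case
      using subspace_0[OF V] linear_0[OF g(1)] by (metis scaleR_zero_left)
  next
    case (step c x y)
    have lf: "linear_on V (\<lambda>v. f v w)" using f w by (auto simp: bilinear_on_def)
    have xV: "x \<in> V" using B step by blast
    have y: "y \<in> V" "g (y \<otimes> w) = f y w" using step by auto
    have "g ((c *\<^sub>R x + y) \<otimes> w) = c *\<^sub>R g (x \<otimes> w) + g (y \<otimes> w)"
      by (simp only: addr linear_add[OF g(1)] linear_scale[OF g(1)])
    also have "\<dots> = f (c *\<^sub>R x) w + f y w"
      using lf xV g1[OF step(1) w] y(2) by (simp add: linear_on_def)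
    also have "\<dots> = f (c *\<^sub>R x + y) w"
      using lf xV y(1) V by (simp add: linear_on_def subspace_scale)
    finally show ?case using xV y(1) V by (simp add: subspace_add subspace_scale)
  qed
  then show ?thesis using g(1) sB by blast
qed

lemma tensor_lift:
  assumes "subspace V" "subspace W" "bilinear_on V W f"
  shows "linear (tensor_lift V W f)"
    and "\<And>v w. v \<in> V \<Longrightarrow> w \<in> W \<Longrightarrow> tensor_lift V W f (v \<otimes> w) = f v w"
  using someI_ex[OF tensor_lift_exists[OF assms]] unfolding tensor_lift_def by auto

lemma tensor_lift_eqI:
  assumes V: "subspace V" and W: "subspace W" and f: "bilinear_on V W f"
    and g: "linear g" "\<And>v w. v \<in> V \<Longrightarrow> w \<in> W \<Longrightarrow> g (v \<otimes> w) = f v w"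
    and t: "t \<in> tensor_space V W"
  shows "tensor_lift V W f t = g t"
  by (rule linear_eq_on_span[OF tensor_lift(1)[OF V W f] g(1) _ t[unfolded tensor_space_def]])
    (auto simp: tensor_lift(2)[OF V W f] g(2))

lemma bilinear_on_tensor_lift:
  fixes F :: "'v::real_vector \<Rightarrow> 'w::real_vector \<Rightarrow> 'v \<Rightarrow> 'w \<Rightarrow> 'u::real_vector"
  assumes V: "subspace V" and W: "subspace W"
    and F: "\<And>v w. v \<in> V \<Longrightarrow> w \<in> W \<Longrightarrow> bilinear_on V W (F v w)"
    and F': "\<And>v w. v \<in> V \<Longrightarrow> w \<in> W \<Longrightarrow> bilinear_on V W (\<lambda>v' w'. F v' w' v w)"
    and t: "t \<in> tensor_space V W"
  shows "bilinear_on V W (\<lambda>v w. tensor_lift V W (F v w) t)"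
proof -
  note lin = tensor_lift(1)[OF V W F] and val = tensor_lift(2)[OF V W F]
  have "tensor_lift V W (F v (w + w')) t = tensor_lift V W (F v w) t + tensor_lift V W (F v w') t"
    if h: "v \<in> V" "w \<in> W" "w' \<in> W" for v w w'
    using h F' W
    by (intro tensor_lift_eqI[OF V W F _ _ t])
      (auto intro!: linear_compose_add lin simp: val subspace_add bilinear_on_def linear_on_def)
  moreover have "tensor_lift V W (F v (c *\<^sub>R w)) t = c *\<^sub>R tensor_lift V W (F v w) t"
    if h: "v \<in> V" "w \<in> W" for v w c
    using h F' W
    by (intro tensor_lift_eqI[OF V W F _ _ t])
      (auto intro!: linear_compose_scale_right lin simp: val subspace_scale bilinear_on_def linear_on_def)
  moreover have "tensor_lift V W (F (v + v') w) t = tensor_lift V W (F v w) t + tensor_lift V W (F v' w) t"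
    if h: "v \<in> V" "v' \<in> V" "w \<in> W" for v v' w
    using h F' V
    by (intro tensor_lift_eqI[OF V W F _ _ t])
      (auto intro!: linear_compose_add lin simp: val subspace_add bilinear_on_def linear_on_def)
  moreover have "tensor_lift V W (F (c *\<^sub>R v) w) t = c *\<^sub>R tensor_lift V W (F v w) t"
    if h: "v \<in> V" "w \<in> W" for v w c
    using h F' V
    by (intro tensor_lift_eqI[OF V W F _ _ t])
      (auto intro!: linear_compose_scale_right lin simp: val subspace_scale bilinear_on_def linear_on_def)
  ultimately show ?thesis by (simp add: bilinear_on_def linear_on_def)
qed

lemma tensor_simps:
  "v \<otimes> (w + w') = v \<otimes> w + v \<otimes> w'" "(v + v') \<otimes> w = v \<otimes> w + v' \<otimes> w"
  "v \<otimes> (k *\<^sub>R w) = k *\<^sub>R (v \<otimes> w)" "(k *\<^sub>R v) \<otimes> w = k *\<^sub>R (v \<otimes> w)"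
  "v \<otimes> 0 = 0" "0 \<otimes> w = 0"
  by (auto simp: tensor_def fun_eq_iff scaleR_fun_def bilinear_ladd bilinear_radd
      bilinear_lmul bilinear_rmul bilinear_lzero bilinear_rzero)

lemma H2_iff: "A \<in> H2 K \<longleftrightarrow> (\<forall>i j. cconj K (A $ i $ j) = A $ j $ i)"
  unfolding H2_def mem_Collect_eq by metis

lemma H2_subspace:
  assumes K: "composition_algebra K"
  shows "subspace (H2 K)" and "subspace (H2' K)"
proof -
  have "cconj K 0 = 0" using calg_cconj_scale[OF K, of 0 0] by simp
  then show 1: "subspace (H2 K)"
    by (simp add: subspace_def H2_iff calg_cconj_add[OF K] calg_cconj_scale[OF K])
  show "subspace (H2' K)"
    unfolding H2'_def using 1
    by (auto simp: subspace_def tr_def sum.distrib scaleR_sum_right[symmetric])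
qed

lemma bilinear_jordan:
  assumes K: "composition_algebra K"
  shows "bilinear (jordan K)"
  unfolding bilinear_def jordan_def mat_mult_def
  by (intro conjI allI linearI)
    (simp_all add: vec_eq_iff calg_mult_simps[OF K] sum.distrib scaleR_sum_right[symmetric] algebra_simps)

lemma jordan_in_H2:
  assumes K: "composition_algebra K" and A: "A \<in> H2 K" and B: "B \<in> H2 K"
  shows "jordan K A B \<in> H2 K"
proof -
  have "linear (cconj K)"
    by (rule linearI) (simp_all add: calg_cconj_add[OF K] calg_cconj_scale[OF K])
  note s = linear_sum[OF this]
  have m: "cconj K (mat_mult K A B $ j $ i) = mat_mult K B A $ i $ j"
    if "A \<in> H2 K" "B \<in> H2 K" for A B i j
  proof -
    have a: "cconj K (A $ j $ k) = A $ k $ j" and b: "cconj K (B $ k $ i) = B $ i $ k" for k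
      using that by (simp_all add: H2_iff)
    show ?thesis by (simp add: mat_mult_def s calg_cconj_mult[OF K] a b)
  qed
  show ?thesis using m[OF A B] m[OF B A]
    by (simp add: H2_iff jordan_def calg_cconj_add[OF K] add.commute)
qed

lemma commutator_R_op:
  assumes K: "composition_algebra K" and A: "A \<in> H2 K" and B: "B \<in> H2 K"
  shows "commutator (R_op K A) (R_op K B) =
    on_space (H2 K) (\<lambda>C. jordan K A (jordan K B C) - jordan K B (jordan K A C))"
  using jordan_in_H2[OF K A] jordan_in_H2[OF K B] bilinear_rzero[OF bilinear_jordan[OF K]]
  by (auto simp: fun_eq_iff commutator_def R_op_def on_space_def)

lemma L2_bracket:
  fixes K1 :: "'k::real_vector calg" and K2 :: "'l::real_vector calg"
  assumes K1: "composition_algebra K1" and K2: "composition_algebra K2"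
    and D: "D \<in> Der_H2 K1" and D': "D' \<in> Der_H2 K1"
    and E: "E \<in> carrier (so (pure K2) (cnorm K2))" and E': "E' \<in> carrier (so (pure K2) (cnorm K2))"
    and A: "A \<in> H2' K1" and B: "B \<in> H2' K1" and x: "x \<in> pure K2" and y: "y \<in> pure K2"
  shows "bracket (L2 K1 K2) (D, 0, 0) (D', 0, 0) = (commutator D D', 0, 0)"
    and "bracket (L2 K1 K2) (0, 0, E) (0, 0, E') = (0, 0, commutator E E')"
    and "bracket (L2 K1 K2) (D, 0, 0) (0, 0, E) = (0, 0, 0)"
    and "bracket (L2 K1 K2) (D, 0, 0) (0, A \<otimes> x, 0) = (0, D A \<otimes> x, 0)"
    and "bracket (L2 K1 K2) (0, 0, E) (0, A \<otimes> x, 0) = (0, A \<otimes> E x, 0)"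
    and "bracket (L2 K1 K2) (0, A \<otimes> x, 0) (0, B \<otimes> y, 0) =
      (- (cinner K2 x y *\<^sub>R commutator (R_op K1 A) (R_op K1 B)), 0, mat_inner K1 A B *\<^sub>R S_op K2 x y)"
proof -
  let ?V = "H2' K1" and ?W = "pure K2"
  note V = H2_subspace(2)[OF K1] and W = calg_pure_subspace[OF K2]
  note lift = tensor_lift[OF V W]
  have VH: "A \<in> H2 K1" if "A \<in> ?V" for A using that by (simp add: H2'_def)
  have act: "bilinear_on ?V ?W (\<lambda>A x. D A \<otimes> x + A \<otimes> E x)"
    if "linear_on ?V D" "linear_on ?W E" for D :: "'k^2^2 \<Rightarrow> 'k^2^2" and E :: "'l \<Rightarrow> 'l"
    using that by (simp add: bilinear_on_def linear_on_def tensor_simps algebra_simps)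
  have linD: "linear_on ?V D" if "D \<in> Der_H2 K1" for D
    using that VH unfolding Der_H2_def endo_def linear_on_def by blast
  have linE: "linear_on ?W E" if "E \<in> carrier (so ?W (cnorm K2))" for E
    using that unfolding so_def endo_def by simp
  have lin0: "linear_on ?V (0 :: 'k^2^2 \<Rightarrow> 'k^2^2)" "linear_on ?W (0 :: 'l \<Rightarrow> 'l)"
    by (simp_all add: linear_on_def)
  have act0: "L2_act K1 K2 D E 0 = 0" if "linear_on ?V D" "linear_on ?W E" for D E
    unfolding L2_act_def by (rule linear_0[OF lift(1)[OF act[OF that]]])
  have actv: "L2_act K1 K2 D E (A \<otimes> x) = D A \<otimes> x + A \<otimes> E x"
    if "linear_on ?V D" "linear_on ?W E" "A \<in> ?V" "x \<in> ?W" for D E A x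
    unfolding L2_act_def by (rule lift(2)[OF act[OF that(1,2)] that(3,4)])
  have D0: "D 0 = 0" if "D \<in> Der_H2 K1" for D
  proof -
    have "D (0 *\<^sub>R 0) = 0 *\<^sub>R D 0"
      using linD[OF that] subspace_0[OF V] unfolding linear_on_def by blast
    then show ?thesis by simp
  qed
  have E0: "E 0 = 0" if "E \<in> carrier (so ?W (cnorm K2))" for E
  proof -
    have "E (0 *\<^sub>R 0) = 0 *\<^sub>R E 0"
      using linE[OF that] subspace_0[OF W] unfolding linear_on_def by blast
    then show ?thesis by simp
  qed
  let ?F = "\<lambda>A x B y. - (cinner K2 x y *\<^sub>R commutator (R_op K1 A) (R_op K1 B))"
  let ?G = "\<lambda>A x B y. mat_inner K1 A B *\<^sub>R S_op K2 x y"
  note j = bilinear_jordan[OF K1]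
  note js = bilinear_ladd[OF j] bilinear_radd[OF j] bilinear_lmul[OF j] bilinear_rmul[OF j]
  note ps = calg_polar_simps[OF K2] calg_polar_simps[OF K1]
  have Fs: "commutator (R_op K1 A) (R_op K1 B) C =
      (if C \<in> H2 K1 then jordan K1 A (jordan K1 B C) - jordan K1 B (jordan K1 A C) else 0)"
    if "A \<in> ?V" "B \<in> ?V" for A B C
    unfolding commutator_R_op[OF K1 VH[OF that(1)] VH[OF that(2)]] on_space_def ..
  have F1: "bilinear_on ?V ?W (?F A x)" if "A \<in> ?V" "x \<in> ?W" for A x
    using that(1) V
    by (auto simp: bilinear_on_def linear_on_def Fs subspace_add subspace_scale fun_eq_iff
        scaleR_fun_def calg_cinner[OF K2] js ps algebra_simps)
  have F2: "bilinear_on ?V ?W (\<lambda>A x. ?F A x B y)" if "B \<in> ?V" "y \<in> ?W" for B y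
    using that(1) V
    by (auto simp: bilinear_on_def linear_on_def Fs subspace_add subspace_scale fun_eq_iff
        scaleR_fun_def calg_cinner[OF K2] js ps algebra_simps)
  have mi: "mat_inner K1 A B = polar (cnorm K1) (tr (jordan K1 A B)) (cone K1)" for A B
    by (simp add: mat_inner_def calg_re[OF K1])
  have tr: "tr (A + B) = tr A + tr B" "tr (c *\<^sub>R A) = c *\<^sub>R tr A" for A B :: "'k^2^2" and c
    by (simp_all add: tr_def sum.distrib scaleR_sum_right)
  have G1: "bilinear_on ?V ?W (?G A x)" for A x
    by (auto simp: bilinear_on_def linear_on_def mi S_op_def calg_cinner[OF K2] tr fun_eq_iff
        scaleR_fun_def on_space_def js ps algebra_simps)
  have G2: "bilinear_on ?V ?W (\<lambda>A x. ?G A x B y)" for B y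
    by (auto simp: bilinear_on_def linear_on_def mi S_op_def calg_cinner[OF K2] tr fun_eq_iff
        scaleR_fun_def on_space_def js ps algebra_simps)
  have ts: "0 \<in> tensor_space ?V ?W" "B \<otimes> y \<in> tensor_space ?V ?W"
    using B y by (auto simp: tensor_space_def span_0 intro!: span_base)
  have der0: "L2_tensor_bracket_Der K1 K2 0 t = 0" if "t \<in> tensor_space ?V ?W" for t
    unfolding L2_tensor_bracket_Der_def
    by (rule linear_0[OF lift(1)[OF bilinear_on_tensor_lift[OF V W F1 F2 that]]])
  have so0: "L2_tensor_bracket_so K1 K2 0 t = 0" if "t \<in> tensor_space ?V ?W" for t
    unfolding L2_tensor_bracket_so_def
    by (rule linear_0[OF lift(1)[OF bilinear_on_tensor_lift[OF V W G1 G2 that]]])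
  have derv: "L2_tensor_bracket_Der K1 K2 (A \<otimes> x) (B \<otimes> y) = ?F A x B y"
    unfolding L2_tensor_bracket_Der_def
    by (rule trans[OF lift(2)[OF bilinear_on_tensor_lift[where F = ?F, OF V W F1 F2 ts(2)] A x]
          lift(2)[OF F1[OF A x] B y]])
  have sov: "L2_tensor_bracket_so K1 K2 (A \<otimes> x) (B \<otimes> y) = ?G A x B y"
    unfolding L2_tensor_bracket_so_def
    by (rule trans[OF lift(2)[OF bilinear_on_tensor_lift[where F = ?G, OF V W G1 G2 ts(2)] A x]
          lift(2)[OF G1 B y]])
  have tAx: "A \<otimes> x \<in> tensor_space ?V ?W"
    using A x by (auto simp: tensor_space_def intro!: span_base)
  have c0: "commutator D 0 = 0" "commutator 0 D = 0" if "D \<in> Der_H2 K1" for D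
    using D0[OF that] by (auto simp: commutator_def fun_eq_iff)
  have e0: "commutator E 0 = 0" "commutator 0 E = 0" if "E \<in> carrier (so ?W (cnorm K2))" for E
    using E0[OF that] by (auto simp: commutator_def fun_eq_iff)
  have c00: "commutator 0 (0 :: 'v::real_vector \<Rightarrow> 'v) = 0" by (simp add: commutator_def fun_eq_iff)
  note simps = L2_def act0 actv lin0 linD[OF D] linD[OF D'] linE[OF E] linE[OF E'] der0[OF ts(1)]
    so0[OF ts(1)] der0[OF tAx] so0[OF tAx] c0[OF D] e0[OF E] c00 derv sov tensor_simps(5,6) A B x y
  show "bracket (L2 K1 K2) (D, 0, 0) (D', 0, 0) = (commutator D D', 0, 0)"
    and "bracket (L2 K1 K2) (0, 0, E) (0, 0, E') = (0, 0, commutator E E')"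
    and "bracket (L2 K1 K2) (D, 0, 0) (0, 0, E) = (0, 0, 0)"
    and "bracket (L2 K1 K2) (D, 0, 0) (0, A \<otimes> x, 0) = (0, D A \<otimes> x, 0)"
    and "bracket (L2 K1 K2) (0, 0, E) (0, A \<otimes> x, 0) = (0, A \<otimes> E x, 0)"
    and "bracket (L2 K1 K2) (0, A \<otimes> x, 0) (0, B \<otimes> y, 0) =
      (- (cinner K2 x y *\<^sub>R commutator (R_op K1 A) (R_op K1 B)), 0, mat_inner K1 A B *\<^sub>R S_op K2 x y)"
    by (simp_all add: simps)
qed

end

theory Submission
  imports Defs
begin

text \<open>For traceless hermitian \<open>A\<close>, \<open>B\<close> the Jordan product \<open>A \<cdot> B\<close> is a multiple of the identity, so
  \<open>H\<^sub>2(K\<^sub>1)\<close> is the spin factor of the quadratic space \<open>H\<^sub>2'(K\<^sub>1) \<cong> K\<^sub>1 + \<real>\<close> and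
  \<open>Der H\<^sub>2(K\<^sub>1) = so(H\<^sub>2'(K\<^sub>1))\<close>. Since \<open>K\<^sub>1 + K\<^sub>2 \<cong> H\<^sub>2'(K\<^sub>1) + K\<^sub>2'\<close> isometrically, the derivations
  and \<open>so(K\<^sub>2')\<close> form the block diagonal part of \<open>so(K\<^sub>1 + K\<^sub>2)\<close>, while \<open>A \<otimes> x\<close> acts as twice the
  infinitesimal rotation in the plane of \<open>A\<close> and \<open>x\<close>. An orthonormal basis of \<open>H\<^sub>2'(K\<^sub>1)\<close> recovers the
  tensor from the off-diagonal block. This works for every composition algebra \<open>K\<^sub>2\<close>; in the split
  case the form on \<open>K\<^sub>1 + K\<^sub>2\<close> has signature \<open>(\<nu>\<^sub>1 + \<nu>\<^sub>2/2, \<nu>\<^sub>2/2)\<close>.\<close>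

subsection \<open>Orthogonal Lie algebras\<close>

lemma linear_on_0:
  assumes "linear_on V f" "x \<in> V"
  shows "f 0 = 0"
  using assms unfolding linear_on_def by (metis scaleR_zero_left)

lemma linear_on_diff:
  assumes "subspace V" "linear_on V f" "x \<in> V" "y \<in> V"
  shows "f (x - y) = f x - f y"
proof -
  have "f (x + (-1) *\<^sub>R y) = f x + (-1) *\<^sub>R f y"
    using assms unfolding linear_on_def by (metis subspace_scale)
  then show ?thesis by simp
qed

lemma endoD:
  assumes "T \<in> endo V"
  shows "linear_on V T" "x \<in> V \<Longrightarrow> T x \<in> V" "x \<notin> V \<Longrightarrow> T x = 0"
  using assms by (auto simp: endo_def)

lemma endo_commutator:
  assumes V: "subspace V" and S: "S \<in> endo V" and T: "T \<in> endo V"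
  shows "commutator S T \<in> endo V"
proof -
  have 0: "0 \<in> V" using V by (rule subspace_0)
  have lS: "S (x + y) = S x + S y" "S (c *\<^sub>R x) = c *\<^sub>R S x" if "x \<in> V" "y \<in> V" for x y c
    using endoD(1)[OF S] that unfolding linear_on_def by auto
  have lT: "T (x + y) = T x + T y" "T (c *\<^sub>R x) = c *\<^sub>R T x" if "x \<in> V" "y \<in> V" for x y c
    using endoD(1)[OF T] that unfolding linear_on_def by auto
  have st: "S x \<in> V" "T x \<in> V" if "x \<in> V" for x
    using endoD(2) S T that by auto
  have z: "S x = 0" "T x = 0" if "x \<notin> V" for x
    using endoD(3) S T that by auto
  \<comment> \<open>Outside \<open>V\<close> the inner map already gives 0, so the commutator
    vanishes there only because the outer map fixes 0.\<close>
  have z0: "S 0 = 0" "T 0 = 0" using linear_on_0 endoD(1) S T 0 by blast+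
  show ?thesis
    unfolding endo_def linear_on_def commutator_def mem_Collect_eq
  proof (intro conjI ballI allI impI)
    fix x y assume h: "x \<in> V" "y \<in> V"
    show "S (T (x + y)) - T (S (x + y)) = S (T x) - T (S x) + (S (T y) - T (S y))"
      using h st[OF h(1)] st[OF h(2)] by (simp add: lS lT)
  next
    fix c x assume h: "x \<in> V"
    show "S (T (c *\<^sub>R x)) - T (S (c *\<^sub>R x)) = c *\<^sub>R (S (T x) - T (S x))"
      using h st[OF h] by (simp add: lS lT algebra_simps)
  qed (use V st z z0 in \<open>auto simp: subspace_diff\<close>)
qed

lemma subspace_endo:
  assumes V: "subspace V"
  shows "subspace (endo V)"
  using V by (auto simp: subspace_def endo_def linear_on_def scaleR_fun_def algebra_simps)

lemma so_iff:
  "T \<in> carrier (so V q) \<longleftrightarrow>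
    T \<in> endo V \<and> (\<forall>x\<in>V. \<forall>y\<in>V. polar q (T x) y = - polar q x (T y))"
  by (simp add: so_def)

lemma bracket_so [simp]: "bracket (so V q) = commutator"
  by (simp add: so_def)

lemma bilinear_simps:
  assumes "bilinear h"
  shows "h (x + y) z = h x z + h y z" "h z (x + y) = h z x + h z y"
    "h (c *\<^sub>R x) z = c *\<^sub>R h x z" "h z (c *\<^sub>R x) = c *\<^sub>R h z x"
    "h (x - y) z = h x z - h y z" "h z (x - y) = h z x - h z y"
    "h (- x) z = - h x z" "h z (- x) = - h z x" "h 0 z = 0" "h z 0 = 0"
  by (simp_all add: bilinear_ladd[OF assms] bilinear_radd[OF assms] bilinear_lmul[OF assms]
      bilinear_rmul[OF assms] bilinear_lsub[OF assms] bilinear_rsub[OF assms]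
      bilinear_lneg[OF assms] bilinear_rneg[OF assms] bilinear_lzero[OF assms] bilinear_rzero[OF assms])

lemma subspace_so:
  assumes V: "subspace V" and q: "bilinear (polar q)"
  shows "subspace (carrier (so V q))"
proof -
  have "subspace {T. \<forall>x\<in>V. \<forall>y\<in>V. polar q (T x) y = - polar q x (T y)}"
    by (auto simp: subspace_def bilinear_simps[OF q] scaleR_fun_def)
  then have "subspace (endo V \<inter> {T. \<forall>x\<in>V. \<forall>y\<in>V. polar q (T x) y = - polar q x (T y)})"
    by (rule subspace_inter[OF subspace_endo[OF V]])
  then show ?thesis by (simp add: so_def Int_def)
qed

lemma so_commutator:
  assumes V: "subspace V" and q: "bilinear (polar q)"
    and S: "S \<in> carrier (so V q)" and T: "T \<in> carrier (so V q)"
  shows "commutator S T \<in> carrier (so V q)"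
proof -
  have e: "S \<in> endo V" "T \<in> endo V" using S T by (auto simp: so_iff)
  have "S x \<in> V" "T x \<in> V" if "x \<in> V" for x using e endoD(2) that by auto
  then show ?thesis
    using endo_commutator[OF V e] S T
    by (simp add: so_iff commutator_def bilinear_simps[OF q])
qed

lemma lie_algebra_so:
  assumes V: "subspace V" and q: "bilinear (polar q)"
  shows "lie_algebra (so V q)"
  unfolding lie_algebra_def bracket_so
proof (intro conjI ballI)
  let ?C = "carrier (so V q)"
  note V0 = subspace_0[OF V]
  have lin: "linear_on V T" if "T \<in> ?C" for T using that endoD(1) by (auto simp: so_iff)
  \<comment> \<open>No restriction to \<open>x \<in> V\<close>: outside \<open>V\<close> the value
    is 0, which lies in \<open>V\<close>. Hence the identities below hold at every point of the
    ambient type.\<close>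
  have V': "T x \<in> V" if "T \<in> ?C" for T x
    using that V0 endoD(2,3)[of T V x] by (cases "x \<in> V") (auto simp: so_iff)
  have add: "T (S x + R x) = T (S x) + T (R x)" and sc: "T (c *\<^sub>R S x) = c *\<^sub>R T (S x)"
    if "T \<in> ?C" "S \<in> ?C" "R \<in> ?C" for T S R x c
    using lin[OF that(1)] V'[OF that(2)] V'[OF that(3)]
    unfolding linear_on_def by auto
  \<comment> \<open>The shape produced by a nested commutator. Only the outer maps \<open>S\<close>
    and \<open>R\<close> have to put their values into \<open>V\<close>.\<close>
  have df: "T (S (S' x) - R (R' x)) = T (S (S' x)) - T (R (R' x))"
    if "T \<in> ?C" "S \<in> ?C" "R \<in> ?C" for T S R S' R' x
    using V'[OF that(2)] V'[OF that(3)] linear_on_diff[OF V lin[OF that(1)]] by auto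
  show "subspace ?C" by (rule subspace_so[OF V q])
  show "commutator S T \<in> ?C" if "S \<in> ?C" "T \<in> ?C" for S T
    by (rule so_commutator[OF V q that])
  show "bilinear_on ?C ?C commutator"
    by (auto simp: bilinear_on_def linear_on_def commutator_def fun_eq_iff scaleR_fun_def add sc
        algebra_simps)
  show "commutator T T = 0" for T by (simp add: commutator_def fun_eq_iff)
  show "commutator R (commutator S T) + commutator S (commutator T R) +
      commutator T (commutator R S) = 0"
    if "R \<in> ?C" "S \<in> ?C" "T \<in> ?C" for R S T
    using that by (simp add: commutator_def fun_eq_iff df)
qed

text \<open>The Lie axioms of \<open>L\<close> are pulled back from \<open>M\<close>: each identity
  is checked after applying the injective map \<phi>. This yields the Jacobi identity of
  \<open>L2\<close> without computing with tensors.\<close>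

lemma lie_isoI:
  fixes L :: "'g::real_vector lie" and M :: "'h::real_vector lie"
  assumes M: "lie_algebra M" and sub: "subspace (carrier L)"
    and closed: "\<And>x y. x \<in> carrier L \<Longrightarrow> y \<in> carrier L \<Longrightarrow> bracket L x y \<in> carrier L"
    and lin: "linear_on (carrier L) \<phi>" and bij: "bij_betw \<phi> (carrier L) (carrier M)"
    and hom: "\<And>x y. x \<in> carrier L \<Longrightarrow> y \<in> carrier L \<Longrightarrow> \<phi> (bracket L x y) = bracket M (\<phi> x) (\<phi> y)"
  shows "L \<cong>\<^sub>L M"
proof -
  let ?C = "carrier L"
  have inj: "x = y" if "\<phi> x = \<phi> y" "x \<in> ?C" "y \<in> ?C" for x y
    using bij that by (auto simp: bij_betw_def inj_on_def)
  have im: "\<phi> x \<in> carrier M" if "x \<in> ?C" for x using bij that by (auto simp: bij_betw_def)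
  have add: "\<phi> (x + y) = \<phi> x + \<phi> y" if "x \<in> ?C" "y \<in> ?C" for x y
    using lin that by (auto simp: linear_on_def)
  have sc: "\<phi> (c *\<^sub>R x) = c *\<^sub>R \<phi> x" if "x \<in> ?C" for x c
    using lin that by (auto simp: linear_on_def)
  have cl: "x + y \<in> ?C" if "x \<in> ?C" "y \<in> ?C" for x y
    using sub that by (auto simp: subspace_def)
  have cl': "c *\<^sub>R x \<in> ?C" if "x \<in> ?C" for x c
    using sub that by (auto simp: subspace_def)
  have z: "0 \<in> ?C" "\<phi> 0 = 0" using subspace_0[OF sub] linear_on_0[OF lin] by auto
  have Mb: "bracket M (x + y) w = bracket M x w + bracket M y w"
    "bracket M w (x + y) = bracket M w x + bracket M w y"
    if "x \<in> carrier M" "y \<in> carrier M" "w \<in> carrier M" for x y w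
    using M that unfolding lie_algebra_def bilinear_on_def linear_on_def by auto
  have Mc: "bracket M (c *\<^sub>R x) w = c *\<^sub>R bracket M x w"
    "bracket M w (c *\<^sub>R x) = c *\<^sub>R bracket M w x"
    if "x \<in> carrier M" "w \<in> carrier M" for x w c
    using M that unfolding lie_algebra_def bilinear_on_def linear_on_def by auto
  have M0: "bracket M x x = 0" if "x \<in> carrier M" for x
    using M that unfolding lie_algebra_def by auto
  have Mj: "bracket M x (bracket M y w) + bracket M y (bracket M w x) + bracket M w (bracket M x y) = 0"
    if "x \<in> carrier M" "y \<in> carrier M" "w \<in> carrier M" for x y w
    using M that unfolding lie_algebra_def by auto
  note s = closed cl cl' hom add sc im Mb Mc M0 Mj
  have "lie_algebra L"
    unfolding lie_algebra_def bilinear_on_def linear_on_def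
  proof (intro conjI ballI allI)
    fix x y w c assume h: "x \<in> ?C" "y \<in> ?C" "w \<in> ?C"
    show "bracket L x (y + w) = bracket L x y + bracket L x w"
      by (rule inj) (simp_all add: s h)
    show "bracket L (y + w) x = bracket L y x + bracket L w x"
      by (rule inj) (simp_all add: s h)
    show "bracket L x (bracket L y w) + bracket L y (bracket L w x) + bracket L w (bracket L x y) = 0"
      by (rule inj) (simp_all add: s h z)
  next
    fix x y c assume h: "x \<in> ?C" "y \<in> ?C"
    show "bracket L x (c *\<^sub>R y) = c *\<^sub>R bracket L x y"
      by (rule inj) (simp_all add: s h)
    show "bracket L (c *\<^sub>R y) x = c *\<^sub>R bracket L y x"
      by (rule inj) (simp_all add: s h)
    show "bracket L x x = 0"
      by (rule inj) (simp_all add: s h z)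
  qed (use sub closed in auto)
  then show ?thesis unfolding lie_iso_def using M lin bij hom by blast
qed

lemma lie_iso_trans:
  assumes "L \<cong>\<^sub>L M" "M \<cong>\<^sub>L N"
  shows "L \<cong>\<^sub>L N"
proof -
  obtain f where L: "lie_algebra L" and f: "linear_on (carrier L) f" "bij_betw f (carrier L) (carrier M)"
    "\<forall>x\<in>carrier L. \<forall>y\<in>carrier L. f (bracket L x y) = bracket M (f x) (f y)"
    using assms(1) unfolding lie_iso_def by blast
  obtain g where N: "lie_algebra N" and g: "linear_on (carrier M) g" "bij_betw g (carrier M) (carrier N)"
    "\<forall>x\<in>carrier M. \<forall>y\<in>carrier M. g (bracket M x y) = bracket N (g x) (g y)"
    using assms(2) unfolding lie_iso_def by blast
  have fM: "f x \<in> carrier M" if "x \<in> carrier L" for x using f(2) that by (auto simp: bij_betw_def)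
  have "linear_on (carrier L) (g \<circ> f)" using f(1) g(1) fM by (auto simp: linear_on_def)
  moreover have "\<forall>x\<in>carrier L. \<forall>y\<in>carrier L. (g \<circ> f) (bracket L x y) = bracket N ((g \<circ> f) x) ((g \<circ> f) y)"
    using f(3) g(3) fM by auto
  ultimately show ?thesis using L N bij_betw_trans[OF f(2) g(2)] unfolding lie_iso_def by blast
qed

text \<open>Conjugation by an isometry of subspaces. Both transported maps are cut off by
  \<open>on_space\<close> so that they are again elements of \<open>endo\<close>.\<close>

lemma so_iso:
  fixes f :: "'v::real_vector \<Rightarrow> 'w::real_vector" and g :: "'w \<Rightarrow> 'v"
  assumes V: "subspace V" and W: "subspace W" and p: "bilinear (polar p)" and q: "bilinear (polar q)"
    and f: "linear_on V f" "\<And>x. x \<in> V \<Longrightarrow> f x \<in> W" "\<And>x. x \<in> V \<Longrightarrow> g (f x) = x"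
    and g: "linear_on W g" "\<And>y. y \<in> W \<Longrightarrow> g y \<in> V" "\<And>y. y \<in> W \<Longrightarrow> f (g y) = y"
    and isometry: "\<And>x y. x \<in> V \<Longrightarrow> y \<in> V \<Longrightarrow> polar q (f x) (f y) = polar p x y"
  shows "so V p \<cong>\<^sub>L so W q"
proof -
  let ?\<phi> = "\<lambda>T. on_space W (\<lambda>y. f (T (g y)))"
  let ?\<psi> = "\<lambda>T. on_space V (\<lambda>x. g (T (f x)))"
  \<comment> \<open>Stated for arbitrary spaces because it serves both directions of the
    conjugation.\<close>
  have endo: "on_space W' (\<lambda>y. f' (T (g' y))) \<in> endo W'"
    if "subspace W'" "linear_on V' f'" "linear_on W' g'" "T \<in> endo V'"
      "\<And>x. x \<in> V' \<Longrightarrow> f' x \<in> W'" "\<And>x. x \<in> W' \<Longrightarrow> g' x \<in> V'"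
    for V' :: "'m::real_vector set" and W' :: "'n::real_vector set" and f' g' T
    using that endoD(1,2)[OF that(4)]
    by (auto simp: endo_def linear_on_def on_space_def subspace_add subspace_scale)
  \<comment> \<open>An isometry has its inverse as adjoint; this carries skewness across in both
    directions.\<close>
  have move: "polar q (f x) y = polar p x (g y)" "polar q y (f x) = polar p (g y) x"
    if "x \<in> V" "y \<in> W" for x y
    using isometry[of x "g y"] isometry[of "g y" x] g that by simp_all
  have \<phi>: "?\<phi> T \<in> carrier (so W q)" if "T \<in> carrier (so V p)" for T
    using that endo[OF W f(1) g(1) _ f(2) g(2)] endoD(2)[of T V] g(2)
    by (auto simp: so_iff on_space_def move)
  have \<psi>: "?\<psi> T \<in> carrier (so V p)" if "T \<in> carrier (so W q)" for T
    using that endo[OF V g(1) f(1) _ g(2) f(2)] endoD(2)[of T W] f(2)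
    by (auto simp: so_iff on_space_def move[symmetric] f)
  have \<psi>\<phi>: "?\<psi> (?\<phi> T) = T" if "T \<in> carrier (so V p)" for T
    using that endoD(2,3)[of T V] f(2,3) by (auto simp: so_iff on_space_def fun_eq_iff)
  have \<phi>\<psi>: "?\<phi> (?\<psi> T) = T" if "T \<in> carrier (so W q)" for T
    using that endoD(2,3)[of T W] g(2,3) by (auto simp: so_iff on_space_def fun_eq_iff)
  show ?thesis
  proof (rule lie_isoI[OF lie_algebra_so[OF W q] subspace_so[OF V p]])
    show "bracket (so V p) S T \<in> carrier (so V p)"
      if "S \<in> carrier (so V p)" "T \<in> carrier (so V p)" for S T
      using so_commutator[OF V p that] by simp
    show "linear_on (carrier (so V p)) ?\<phi>"
    proof -
      have "T (g y) \<in> V" if "T \<in> carrier (so V p)" "y \<in> W" for T y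
        using that g(2) endoD(2)[of T V] by (simp add: so_iff)
      then show ?thesis
        using f(1) by (simp add: linear_on_def on_space_def fun_eq_iff scaleR_fun_def)
    qed
    show "bij_betw ?\<phi> (carrier (so V p)) (carrier (so W q))"
      by (rule bij_betw_byWitness[where f' = ?\<psi>]) (use \<phi> \<psi> \<phi>\<psi> \<psi>\<phi> in auto)
    show "?\<phi> (bracket (so V p) S T) = bracket (so W q) (?\<phi> S) (?\<phi> T)"
      if "S \<in> carrier (so V p)" "T \<in> carrier (so V p)" for S T
    proof -
      have "S x \<in> V" "T x \<in> V" if "x \<in> V" for x
        using \<open>S \<in> _\<close> \<open>T \<in> _\<close> endoD(2) that by (auto simp: so_iff)
      moreover have "S 0 = 0" "T 0 = 0"
        using that endoD(1) linear_on_0[OF _ subspace_0[OF V]] by (auto simp: so_iff)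
      ultimately show ?thesis
        using f g linear_on_diff[OF V f(1)] linear_on_0[OF g(1) subspace_0[OF W]]
        by (auto simp: commutator_def on_space_def fun_eq_iff)
    qed
  qed
qed

section \<open>Orthonormal frames and coordinates of signature (s, t)\<close>

definition frame_sign :: "nat \<Rightarrow> nat \<Rightarrow> real" where
  "frame_sign s i = (if i < s then 1 else -1)"

lemma frame_sign_square [simp]: "frame_sign s i * frame_sign s i = 1"
  "frame_sign s i * (frame_sign s i * c) = c"
  by (simp_all add: frame_sign_def)

text \<open>The reproducing formula takes the place of spanning and independence. The norm of each
  frame vector is its own inverse, so the same sign serves as norm and as factor of the coefficient.
  Positive vectors come first, as in \<open>so_pq\<close>.\<close>

definition orthonormal_frame ::
    "('v::real_vector \<Rightarrow> real) \<Rightarrow> nat \<Rightarrow> nat \<Rightarrow> (nat \<Rightarrow> 'v) \<Rightarrow> bool" where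
  "orthonormal_frame q s t b \<longleftrightarrow>
     (\<forall>i<s + t. \<forall>j<s + t. polar q (b i) (b j) = (if i = j then frame_sign s i else 0)) \<and>
     (\<forall>v. v = (\<Sum>i<s + t. (frame_sign s i * polar q v (b i)) *\<^sub>R b i))"

lemma polar_self:
  assumes "quadratic_form q"
  shows "polar q x x = q x"
proof -
  have "q (2 *\<^sub>R x) = 2\<^sup>2 * q x" using assms unfolding quadratic_form_def by blast
  then show ?thesis by (simp add: polar_def scaleR_2)
qed

text \<open>\<open>P\<close> is enumerated by the indices below \<open>s\<close> and
  \<open>N\<close> by the next \<open>t\<close>. Both sides of the reproducing formula are linear in
  \<open>v\<close>, so it suffices to check it on \<open>P \<union> N\<close>.\<close>

lemma has_signature_frame:
  fixes q :: "'v::real_vector \<Rightarrow> real"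
  assumes q: "quadratic_form q" and sig: "has_signature q s t"
  obtains b where "orthonormal_frame q s t b"
proof -
  obtain P N where PN: "finite P" "finite N" "P \<inter> N = {}" "card P = s" "card N = t"
    "span (P \<union> N) = (UNIV :: 'v set)"
    "\<forall>u\<in>P \<union> N. \<forall>v\<in>P \<union> N. u \<noteq> v \<longrightarrow> polar q u v = 0"
    "\<forall>u\<in>P. q u = 1" "\<forall>u\<in>N. q u = -1"
    using sig unfolding has_signature_def by (elim exE conjE) (rule that)
  obtain f where f: "bij_betw f {0..<s} P" using ex_bij_betw_nat_finite[OF PN(1)] PN(4) by auto
  obtain g where g: "bij_betw g {0..<t} N" using ex_bij_betw_nat_finite[OF PN(2)] PN(5) by auto
  define b where "b i = (if i < s then f i else g (i - s))" for i
  have fP: "f i \<in> P" if "i < s" for i using f that by (auto simp: bij_betw_def)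
  have gN: "g i \<in> N" if "i < t" for i using g that by (auto simp: bij_betw_def)
  have bPN: "b i \<in> P \<union> N" if "i < s + t" for i
    using that fP gN by (auto simp: b_def)
  have qb: "q (b i) = frame_sign s i" if "i < s + t" for i
    using that fP gN PN(8,9) by (auto simp: b_def frame_sign_def)
  have binj: "i = j" if "b i = b j" "i < s + t" "j < s + t" for i j
  proof -
    have "f i \<noteq> g k" if "i < s" "k < t" for i k using fP gN PN(3) that by (metis disjoint_iff)
    moreover have "f i = f k \<longleftrightarrow> i = k" if "i < s" "k < s" for i k
      using f that by (auto simp: bij_betw_def inj_on_def)
    moreover have "g i = g k \<longleftrightarrow> i = k" if "i < t" "k < t" for i k
      using g that by (auto simp: bij_betw_def inj_on_def)
    ultimately show ?thesis using that
      by (auto simp: b_def split: if_splits dest: sym)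
  qed
  have surj: "\<exists>k<s + t. u = b k" if "u \<in> P \<union> N" for u
  proof -
    have "P = f ` {0..<s}" "N = g ` {0..<t}" using f g by (auto simp: bij_betw_def)
    with that consider i where "i < s" "u = f i" | i where "i < t" "u = g i" by auto
    then show ?thesis
    proof cases
      case 1 then show ?thesis by (intro exI[of _ i]) (simp add: b_def)
    next
      case 2 then show ?thesis by (intro exI[of _ "s + i"]) (simp add: b_def)
    qed
  qed
  have orth: "polar q (b i) (b j) = (if i = j then frame_sign s i else 0)"
    if "i < s + t" "j < s + t" for i j
    using PN(7) bPN[OF that(1)] bPN[OF that(2)] binj[OF _ that] qb[OF that(1)]
    by (auto simp: polar_self[OF q])
  have bl: "bilinear (polar q)" using q by (simp add: quadratic_form_def)
  have lin: "linear (\<lambda>v. \<Sum>i<s + t. (frame_sign s i * polar q v (b i)) *\<^sub>R b i)"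
    by (rule linearI)
      (simp_all add: bilinear_simps[OF bl] sum.distrib scaleR_sum_right algebra_simps)
  have "v = (\<Sum>i<s + t. (frame_sign s i * polar q v (b i)) *\<^sub>R b i)" for v
  proof (rule linear_eq_on_span[OF linear_ident lin, of "P \<union> N"])
    fix u assume "u \<in> P \<union> N"
    then obtain k where k: "k < s + t" "u = b k" using surj by blast
    have "(\<Sum>i<s + t. (frame_sign s i * polar q u (b i)) *\<^sub>R b i) =
        (\<Sum>i<s + t. if i = k then b i else 0)"
      using k by (intro sum.cong) (auto simp: orth)
    then show "u = (\<Sum>i<s + t. (frame_sign s i * polar q u (b i)) *\<^sub>R b i)"
      using k by simp
  qed (simp add: PN(6))
  with orth have "orthonormal_frame q s t b" by (simp add: orthonormal_frame_def)
  then show ?thesis by (rule that)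
qed

lemma so_iso_so_pq:
  fixes q :: "'v::real_vector \<Rightarrow> real"
  assumes q: "bilinear (polar q)" and b: "orthonormal_frame q s t b"
  shows "so UNIV q \<cong>\<^sub>L so_pq s t"
proof -
  let ?R = "{x::nat \<Rightarrow> real. \<forall>i\<ge>s + t. x i = 0}"
  let ?q = "\<lambda>x::nat \<Rightarrow> real. (\<Sum>i<s. (x i)\<^sup>2) - (\<Sum>i\<in>{s..<s + t}. (x i)\<^sup>2)"
  \<comment> \<open>The coordinates of \<open>v\<close> in the frame; the value 0 from
    \<open>s + t\<close> on places them in \<open>?R\<close>.\<close>
  let ?f = "\<lambda>v i. if i < s + t then frame_sign s i * polar q v (b i) else 0"
  let ?g = "\<lambda>x. \<Sum>i<s + t. x i *\<^sub>R b i"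
  have orth: "polar q (b i) (b j) = (if i = j then frame_sign s i else 0)"
    if "i < s + t" "j < s + t" for i j
    using b that unfolding orthonormal_frame_def by blast
  have gf: "(\<Sum>i<s + t. (frame_sign s i * polar q v (b i)) *\<^sub>R b i) = v" for v
    using b unfolding orthonormal_frame_def by metis
  have "?q x = (\<Sum>i<s + t. frame_sign s i * (x i * x i))" for x
  proof -
    have "{..<s + t} = {..<s} \<union> {s..<s + t}" by auto
    then have "(\<Sum>i<s + t. frame_sign s i * (x i * x i)) =
      (\<Sum>i<s. frame_sign s i * (x i * x i)) + (\<Sum>i\<in>{s..<s + t}. frame_sign s i * (x i * x i))"
      by (simp add: sum.union_disjoint ivl_disj_int)
    then show ?thesis by (simp add: frame_sign_def power2_eq_square sum_negf)
  qed
  then have "polar ?q x y = ((\<Sum>i<s + t. frame_sign s i * ((x i + y i) * (x i + y i))) -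
      (\<Sum>i<s + t. frame_sign s i * (x i * x i)) - (\<Sum>i<s + t. frame_sign s i * (y i * y i))) / 2" for x y
    by (simp add: polar_def)
  moreover have "(\<Sum>i<s + t. frame_sign s i * ((x i + y i) * (x i + y i))) =
      (\<Sum>i<s + t. frame_sign s i * (x i * x i)) + (\<Sum>i<s + t. frame_sign s i * (y i * y i)) +
      2 * (\<Sum>i<s + t. frame_sign s i * (x i * y i))" for x y :: "nat \<Rightarrow> real"
    unfolding sum_distrib_left sum.distrib[symmetric]
    by (intro sum.cong) (simp_all add: algebra_simps)
  ultimately have pol: "polar ?q x y = (\<Sum>i<s + t. frame_sign s i * (x i * y i))" for x y
    by simp
  have linq: "linear (\<lambda>u. polar q u v)" "linear (polar q v)" for v
    using q by (simp_all add: bilinear_def)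
  show ?thesis
    unfolding so_pq_def
  proof (rule so_iso[where f = ?f and g = ?g])
    show "bilinear (polar ?q)"
      unfolding bilinear_def pol
      by (auto intro!: linearI simp: algebra_simps sum.distrib sum_distrib_left scaleR_fun_def)
    show "linear_on UNIV ?f"
      by (auto simp: linear_on_def fun_eq_iff bilinear_simps[OF q] scaleR_fun_def algebra_simps)
    show "linear_on ?R ?g"
      by (auto simp: linear_on_def scaleR_fun_def sum.distrib scaleR_sum_right algebra_simps)
    show "?g (?f v) = v" for v using gf[of v] by simp
    have pg: "polar q (?g x) (b k) = x k * frame_sign s k" if "k < s + t" for x k
    proof -
      have "polar q (?g x) (b k) = (\<Sum>i<s + t. x i * polar q (b i) (b k))"
        by (simp add: linear_sum[OF linq(1)] bilinear_simps[OF q])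
      also have "\<dots> = (\<Sum>i<s + t. if i = k then x k * frame_sign s k else 0)"
        using that by (intro sum.cong) (auto simp: orth)
      finally show ?thesis using that by simp
    qed
    show "?f (?g x) = x" if "x \<in> ?R" for x
      using that by (auto simp: fun_eq_iff pg)
    show "polar ?q (?f x) (?f y) = polar q x y" for x y
    proof -
      have "polar q x y = polar q (\<Sum>i<s + t. (frame_sign s i * polar q x (b i)) *\<^sub>R b i) y"
        by (simp only: gf)
      also have "\<dots> = (\<Sum>i<s + t. frame_sign s i * polar q x (b i) * polar q (b i) y)"
        by (simp add: linear_sum[OF linq(1)] bilinear_simps[OF q])
      finally show ?thesis
        by (simp add: pol polar_commute[of q y] mult.assoc mult.left_commute)
    qed
  qed (auto simp: subspace_def scaleR_fun_def q)
qed

subsection \<open>The Jordan algebra of hermitian matrices of size 2\<close>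

definition unit_mat :: "'k::real_vector calg \<Rightarrow> 'k^2^2" where
  "unit_mat K = (\<chi> i j. if i = j then cone K else 0)"

text \<open>The matrix with rows \<open>(r, x)\<close> and \<open>(cconj K x, - r)\<close>, the
  general traceless hermitian matrix.\<close>

definition spin_mat :: "'k::real_vector calg \<Rightarrow> 'k \<times> real \<Rightarrow> 'k^2^2" where
  "spin_mat K = (\<lambda>(x, r). \<chi> i j. if i = j then (if i = 1 then r else - r) *\<^sub>R cone K
     else if i = 1 then x else cconj K x)"

text \<open>Inverse to \<open>spin_mat\<close> on \<open>H2' K\<close>. Half the difference of the
  diagonal entries, instead of the first entry, makes the map vanish on the unit matrix.\<close>

definition spin_coord :: "'k::real_vector calg \<Rightarrow> 'k^2^2 \<Rightarrow> 'k \<times> real" where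
  "spin_coord K A = (A $ 1 $ 2, re K (A $ 1 $ 1 - A $ 2 $ 2) / 2)"

text \<open>The form of the spin factor: on traceless hermitian \<open>A\<close> its value at
  \<open>(A, A)\<close> is the scalar by which the matrix square of \<open>A\<close> multiplies the
  identity.\<close>

definition spin_form :: "'k::real_vector calg \<Rightarrow> 'k^2^2 \<Rightarrow> 'k^2^2 \<Rightarrow> real" where
  "spin_form K A B = polar (cnorm K) (fst (spin_coord K A)) (fst (spin_coord K B)) +
     snd (spin_coord K A) * snd (spin_coord K B)"

lemma two_index [simp]: "(1::2) \<noteq> 2" "(2::2) \<noteq> 1"
  by (metis exhaust_2 one_neq_zero zero_neq_one)+

lemma spin_mat_index:
  "spin_mat K (x, r) $ 1 $ 1 = r *\<^sub>R cone K" "spin_mat K (x, r) $ 2 $ 2 = - (r *\<^sub>R cone K)"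
  "spin_mat K (x, r) $ 1 $ 2 = x" "spin_mat K (x, r) $ 2 $ 1 = cconj K x"
  by (simp_all add: spin_mat_def)

lemma unit_mat_index:
  "unit_mat K $ 1 $ 1 = cone K" "unit_mat K $ 2 $ 2 = cone K"
  "unit_mat K $ 1 $ 2 = 0" "unit_mat K $ 2 $ 1 = 0"
  by (simp_all add: unit_mat_def)

lemma mat2_eq_iff:
  "A = B \<longleftrightarrow> A $ 1 $ 1 = B $ 1 $ 1 \<and> A $ 1 $ 2 = B $ 1 $ 2 \<and> A $ 2 $ 1 = B $ 2 $ 1 \<and> A $ 2 $ 2 = B $ 2 $ 2"
  for A B :: "'k^2^2"
  by (auto simp: vec_eq_iff forall_2)

context
  fixes K :: "'k::real_vector calg"
  assumes K: "composition_algebra K"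
begin

lemma re_simps:
  "re K (x + y) = re K x + re K y" "re K (c *\<^sub>R x) = c * re K x" "re K (- x) = - re K x"
  "re K (x - y) = re K x - re K y" "re K (cone K) = 1" "re K 0 = 0"
  by (simp_all add: calg_re[OF K] calg_polar_simps[OF K] calg_polar_self[OF K] calg_norm_one[OF K])

lemma cconj_0: "cconj K 0 = 0"
  using calg_cconj_scale[OF K, of 0 0] by simp

lemma cconj_one: "cconj K (c *\<^sub>R cone K) = c *\<^sub>R cone K"
  by (simp add: cconj_def re_simps)

lemma add_cconj: "x + cconj K x = (2 * re K x) *\<^sub>R cone K"
  by (simp add: calg_cconj[OF K] calg_re[OF K])

lemma cconj_eq_self: "cconj K x = x \<longleftrightarrow> x = re K x *\<^sub>R cone K"
proof
  assume "cconj K x = x"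
  then have "2 *\<^sub>R x = 2 *\<^sub>R (re K x *\<^sub>R cone K)"
    using add_cconj[of x] by (simp add: scaleR_2)
  then show "x = re K x *\<^sub>R cone K" by (rule scaleR_left_imp_eq[rotated]) simp
next
  assume "x = re K x *\<^sub>R cone K"
  then show "cconj K x = x" by (metis cconj_one)
qed

lemma linear_spin_mat: "linear (spin_mat K)"
  by (rule linearI)
    (auto simp: spin_mat_def vec_eq_iff calg_cconj_add[OF K] calg_cconj_scale[OF K] algebra_simps)

lemma linear_spin_coord: "linear (spin_coord K)"
  by (rule linearI) (simp_all add: spin_coord_def re_simps algebra_simps add_divide_distrib diff_divide_distrib)

lemma spin_coord_mat [simp]: "spin_coord K (spin_mat K z) = z"
  by (cases z) (simp add: spin_coord_def spin_mat_index re_simps)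

lemma spin_coord_unit [simp]: "spin_coord K (unit_mat K) = 0"
  by (simp add: spin_coord_def unit_mat_index re_simps zero_prod_def)

lemma H2_iff': "A \<in> H2 K \<longleftrightarrow> A $ 1 $ 1 = re K (A $ 1 $ 1) *\<^sub>R cone K \<and>
    A $ 2 $ 2 = re K (A $ 2 $ 2) *\<^sub>R cone K \<and> A $ 2 $ 1 = cconj K (A $ 1 $ 2)"
  unfolding H2_iff forall_2 cconj_eq_self by (metis calg_cconj_cconj[OF K])

lemma spin_mat_H2': "spin_mat K z \<in> H2' K"
proof (cases z)
  case (Pair x r)
  then show ?thesis
    by (simp add: H2'_def H2_iff' spin_mat_index tr_def sum_2 re_simps)
qed

lemma unit_mat_H2: "unit_mat K \<in> H2 K"
  by (simp add: H2_iff' unit_mat_index re_simps cconj_0)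

lemma H2'_eq:
  assumes "A \<in> H2' K"
  shows "spin_mat K (spin_coord K A) = A"
proof -
  have A: "A $ 1 $ 1 = re K (A $ 1 $ 1) *\<^sub>R cone K" "A $ 2 $ 1 = cconj K (A $ 1 $ 2)"
    and 2: "A $ 2 $ 2 = - A $ 1 $ 1"
    using assms by (auto simp: H2'_def H2_iff' tr_def sum_2 eq_neg_iff_add_eq_0 add.commute)
  show ?thesis
    unfolding mat2_eq_iff spin_coord_def spin_mat_index using A
    by (simp add: 2 re_simps)
qed

text \<open>Diagonal entries of a hermitian matrix are real multiples of the unit of
  \<open>K\<close>, so half the trace can be split off as a scalar.\<close>

lemma H2_decompose:
  assumes "A \<in> H2 K"
  obtains A' c where "A' \<in> H2' K" "A = A' + c *\<^sub>R unit_mat K"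
proof -
  let ?c = "re K (tr A) / 2"
  have A: "A $ 1 $ 1 = re K (A $ 1 $ 1) *\<^sub>R cone K" "A $ 2 $ 2 = re K (A $ 2 $ 2) *\<^sub>R cone K"
    using assms by (auto simp: H2_iff')
  have "A - ?c *\<^sub>R unit_mat K \<in> H2 K"
    using assms unit_mat_H2 H2_subspace(1)[OF K] by (simp add: subspace_diff subspace_scale)
  moreover have "tr (A - ?c *\<^sub>R unit_mat K) = 0"
  proof -
    obtain a b where ab: "A $ 1 $ 1 = a *\<^sub>R cone K" "A $ 2 $ 2 = b *\<^sub>R cone K" using A by blast
    have "tr (A - ?c *\<^sub>R unit_mat K) = ((a - (a + b) / 2) + (b - (a + b) / 2)) *\<^sub>R cone K"
      unfolding scaleR_add_left scaleR_diff_left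
      by (simp add: tr_def sum_2 ab unit_mat_index re_simps)
    then show ?thesis by (simp add: field_simps)
  qed
  ultimately show ?thesis
    by (intro that[of "A - ?c *\<^sub>R unit_mat K" ?c]) (simp_all add: H2'_def)
qed

text \<open>\<open>spin_coord\<close> kills the unit matrix and is injective on
  \<open>H2' K\<close>, so it isolates \<open>A\<close>. This permits comparing coefficients in the
  spin factor.\<close>

lemma spin_unit_independent:
  assumes "A \<in> H2' K" "A + c *\<^sub>R unit_mat K = 0"
  shows "A = 0" "c = 0"
proof -
  have "spin_coord K (A + c *\<^sub>R unit_mat K) = 0"
    using assms(2) linear_0[OF linear_spin_coord] by simp
  then have "spin_coord K A = 0"
    by (simp add: linear_add[OF linear_spin_coord] linear_scale[OF linear_spin_coord])
  then show A: "A = 0"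
    using H2'_eq[OF assms(1)] linear_0[OF linear_spin_mat] by simp
  then show "c = 0"
    using assms(2) calg_one_nonzero[OF K] unit_mat_index(1)[of K]
    by (metis add_0 scaleR_eq_0_iff zero_index)
qed

lemma jordan_unit: "jordan K (unit_mat K) A = 2 *\<^sub>R A" "jordan K A (unit_mat K) = 2 *\<^sub>R A"
  by (simp_all add: jordan_def mat_mult_def mat2_eq_iff sum_2 unit_mat_index
      calg_mult_simps[OF K] calg_one[OF K] scaleR_2)

text \<open>The traceless part of the Jordan product vanishes, so that \<open>H\<^sub>2(K)\<close> is the spin factor
  of the quadratic space \<open>H\<^sub>2'(K)\<close>.\<close>

lemma jordan_spin:
  assumes A: "A \<in> H2' K" and B: "B \<in> H2' K"
  shows "jordan K A B = (2 * spin_form K A B) *\<^sub>R unit_mat K"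
proof -
  obtain x r y s where xy: "A = spin_mat K (x, r)" "B = spin_mat K (y, s)"
    using H2'_eq[OF A] H2'_eq[OF B] by (metis surj_pair)
  \<comment> \<open>The two summands are conjugate to each other, so their sum is twice a real
    part.\<close>
  have 1: "cmult K x (cconj K y) + cmult K y (cconj K x) = (2 * polar (cnorm K) x y) *\<^sub>R cone K" for x y
    using add_cconj[of "cmult K x (cconj K y)"]
    by (simp add: calg_cconj_mult[OF K] calg_cconj_cconj[OF K] calg_cinner[OF K, symmetric] cinner_def)
  have 2: "polar (cnorm K) (cconj K x) (cconj K y) = polar (cnorm K) x y"
    by (simp add: calg_polar_cconj[OF K] calg_cconj_cconj[OF K])
  have 3: "cmult K (cconj K x) y + cmult K (cconj K y) x = (2 * polar (cnorm K) x y) *\<^sub>R cone K"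
    using 1[of "cconj K x" "cconj K y"] by (simp add: calg_cconj_cconj[OF K] 2)
  have f: "spin_form K A B = r * s + polar (cnorm K) x y" by (simp add: xy spin_form_def)
  \<comment> \<open>Lets the simplifier apply \<open>1\<close> and \<open>3\<close> inside
    right-nested sums, where the two products do not form a subterm of their own.\<close>
  have 4: "u + (v + w) = z + w" if "u + v = z" for u v w z :: 'k
    using that by (simp add: add.assoc[symmetric])
  have 5: "c *\<^sub>R v + c *\<^sub>R v = (2 * c) *\<^sub>R v" for c and v :: 'k
    by (simp add: scaleR_2 flip: scaleR_scaleR)
  show ?thesis
    unfolding f unfolding xy
    using 4[OF 1[of x y]] 4[OF 3]
    by (simp add: jordan_def mat_mult_def mat2_eq_iff sum_2 unit_mat_index spin_mat_index
        calg_mult_simps[OF K] calg_one[OF K] 5 algebra_simps)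
qed

lemma spin_form_bilinear: "bilinear (spin_form K)"
  unfolding bilinear_def spin_form_def
  by (intro conjI allI linearI)
    (simp_all add: linear_add[OF linear_spin_coord] linear_scale[OF linear_spin_coord]
      calg_polar_simps[OF K] algebra_simps)

lemma spin_form_commute: "spin_form K A B = spin_form K B A"
  by (simp add: spin_form_def polar_commute mult.commute)

text \<open>One factor 2 comes from the Jordan product, the other from the trace of the unit
  matrix.\<close>

lemma mat_inner_spin:
  assumes "A \<in> H2' K" "B \<in> H2' K"
  shows "mat_inner K A B = 4 * spin_form K A B"
  unfolding mat_inner_def jordan_spin[OF assms]
  by (simp add: tr_def sum_2 unit_mat_index re_simps)

text \<open>Derivations are exactly the skew maps of \<open>H2' K\<close>, extended by 0 on the unit
  matrix. A product of traceless matrices is a multiple of the unit, which \<open>D\<close> kills;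
  the derivation rule then becomes skewness. Conversely the whole product is expressed through the
  form and the unit.\<close>

lemma Der_H2_iff:
  "D \<in> Der_H2 K \<longleftrightarrow> D \<in> endo (H2 K) \<and> D (unit_mat K) = 0 \<and>
     (\<forall>A\<in>H2' K. D A \<in> H2' K) \<and> (\<forall>A\<in>H2' K. \<forall>B\<in>H2' K. spin_form K (D A) B = - spin_form K A (D B))"
  (is "?L \<longleftrightarrow> ?R")
proof
  let ?I = "unit_mat K"
  note j = bilinear_simps[OF bilinear_jordan[OF K]]
  assume D: ?L
  then have d: "D (jordan K A B) = jordan K (D A) B + jordan K A (D B)"
    if "A \<in> H2 K" "B \<in> H2 K" for A B
    using that by (auto simp: Der_H2_def)
  have e: "D \<in> endo (H2 K)" using D by (simp add: Der_H2_def)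
  have lin: "D (c *\<^sub>R A) = c *\<^sub>R D A" if "A \<in> H2 K" for A c
    using endoD(1)[OF e] that by (simp add: linear_on_def)
  have H: "A \<in> H2 K" if "A \<in> H2' K" for A using that by (simp add: H2'_def)
  \<comment> \<open>The unit matrix has Jordan square \<open>2 *\<^sub>R ?I\<close>; on the right
    the derivation rule contributes \<open>2 *\<^sub>R D ?I\<close> twice.\<close>
  have "2 *\<^sub>R D ?I = 4 *\<^sub>R D ?I"
    using d[OF unit_mat_H2 unit_mat_H2] lin[OF unit_mat_H2, of 2]
    by (simp add: jordan_unit flip: scaleR_add_left)
  then have I: "D ?I = 0" by simp
  have 0: "jordan K (D A) B + jordan K A (D B) = 0" if "A \<in> H2' K" "B \<in> H2' K" for A B
    using d[OF H[OF that(1)] H[OF that(2)]] lin[OF unit_mat_H2] I by (simp add: jordan_spin[OF that])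
  have V: "D A \<in> H2' K" if A: "A \<in> H2' K" for A
  proof -
    obtain A' c where A': "A' \<in> H2' K" "D A = A' + c *\<^sub>R ?I"
      using H2_decompose[OF endoD(2)[OF e H[OF A]]] .
    \<comment> \<open>The left side is 0 by \<open>0\<close>, while a unit component
      \<open>c\<close> of \<open>D A\<close> would leave the traceless term
      \<open>(4 * c) *\<^sub>R A\<close>.\<close>
    have "jordan K (D A) A + jordan K A (D A) =
        (4 * c) *\<^sub>R A + (2 * (spin_form K A' A + spin_form K A A')) *\<^sub>R ?I"
      by (simp add: A'(2) j jordan_unit jordan_spin A A'(1) algebra_simps flip: scaleR_add_left)
    then have "(4 * c) *\<^sub>R A = 0"
      using 0[OF A A] spin_unit_independent(1)[of "(4 * c) *\<^sub>R A"] A H2_subspace(2)[OF K]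
      by (metis subspace_scale)
    \<comment> \<open>For \<open>A = 0\<close> the equation says nothing about \<open>c\<close>;
      there linearity gives \<open>D A = 0\<close>.\<close>
    then have "c = 0 \<or> A = 0" by simp
    then show ?thesis
    proof
      assume "A = 0"
      then have "D A = 0" using lin[OF H[OF A], of 0] by simp
      then show ?thesis using subspace_0[OF H2_subspace(2)[OF K]] by simp
    qed (use A' in simp)
  qed
  have "spin_form K (D A) B = - spin_form K A (D B)" if "A \<in> H2' K" "B \<in> H2' K" for A B
  proof -
    \<comment> \<open>The leading 0 is the traceless summand in the shape expected by
      \<open>spin_unit_independent\<close>.\<close>
    have "0 + (2 * (spin_form K (D A) B + spin_form K A (D B))) *\<^sub>R ?I = 0"
      using 0[OF that] by (simp add: jordan_spin that V algebra_simps)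
    then have "2 * (spin_form K (D A) B + spin_form K A (D B)) = 0"
      by (rule spin_unit_independent(2)[OF subspace_0[OF H2_subspace(2)[OF K]]])
    then show ?thesis by simp
  qed
  with e I V show ?R by blast
next
  let ?I = "unit_mat K"
  note j = bilinear_simps[OF bilinear_jordan[OF K]]
  assume R: ?R
  have H: "A \<in> H2 K" if "A \<in> H2' K" for A using that by (simp add: H2'_def)
  have D: "D (A + B) = D A + D B" "D (c *\<^sub>R A) = c *\<^sub>R D A" if "A \<in> H2 K" "B \<in> H2 K" for A B c
    using R endoD(1)[of D "H2 K"] that by (auto simp: linear_on_def)
  have cl: "A + B \<in> H2 K" "c *\<^sub>R A \<in> H2 K" if "A \<in> H2 K" "B \<in> H2 K" for A B c
    using that H2_subspace(1)[OF K] by (auto simp: subspace_def)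
  have "D (jordan K A B) = jordan K (D A) B + jordan K A (D B)" if h: "A \<in> H2 K" "B \<in> H2 K" for A B
  proof -
    obtain A' a B' b where A: "A' \<in> H2' K" "A = A' + a *\<^sub>R ?I" and B: "B' \<in> H2' K" "B = B' + b *\<^sub>R ?I"
      using H2_decompose[OF h(1)] H2_decompose[OF h(2)] by metis
    note hh = H[OF A(1)] H[OF B(1)] unit_mat_H2
    have DA: "D A = D A'" and DB: "D B = D B'"
      using R hh by (simp_all add: A(2) B(2) D cl[OF _ unit_mat_H2])
    have "jordan K A B = (2 * b) *\<^sub>R A' + ((2 * a) *\<^sub>R B' + (2 * spin_form K A' B' + 2 * a * b) *\<^sub>R ?I)"
      by (simp add: A(2) B(2) j jordan_unit jordan_spin A(1) B(1) algebra_simps)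
    then have "D (jordan K A B) = (2 * b) *\<^sub>R D A' + (2 * a) *\<^sub>R D B'"
      using R hh by (simp add: D[OF _ unit_mat_H2] D cl[OF _ unit_mat_H2] cl)
    moreover have "jordan K (D A) B + jordan K A (D B) = (2 * b) *\<^sub>R D A' + (2 * a) *\<^sub>R D B'"
      unfolding DA DB unfolding A(2) B(2)
      using R A(1) B(1) by (simp add: j jordan_unit jordan_spin algebra_simps)
    ultimately show ?thesis by simp
  qed
  then show ?L using R by (simp add: Der_H2_def)
qed

lemma subspace_Der_H2: "subspace (Der_H2 K)"
proof -
  note j = bilinear_simps[OF bilinear_jordan[OF K]]
  have "subspace {D. \<forall>A\<in>H2 K. \<forall>B\<in>H2 K. D (jordan K A B) = jordan K (D A) B + jordan K A (D B)}"
    by (simp add: subspace_def j scaleR_fun_def algebra_simps)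
  from subspace_inter[OF subspace_endo[OF H2_subspace(1)[OF K]] this] show ?thesis
    by (simp add: Der_H2_def Int_def)
qed

lemma Der_H2_commutator:
  assumes D: "D \<in> Der_H2 K" and D': "D' \<in> Der_H2 K"
  shows "commutator D D' \<in> Der_H2 K"
proof -
  have "D 0 = 0" "D' 0 = 0"
    using D D' linear_on_0[OF _ subspace_0[OF H2_subspace(1)[OF K]]] endoD(1)
    by (auto simp: Der_H2_def)
  then show ?thesis
    using D D' endo_commutator[OF H2_subspace(1)[OF K]]
      bilinear_simps[OF spin_form_bilinear] subspace_diff[OF H2_subspace(2)[OF K]]
    unfolding Der_H2_iff by (auto simp: commutator_def)
qed

text \<open>The inner product gives a multiple of the unit with factor 2, and multiplying by the
  unit doubles once more. The result is 4 times an infinitesimal rotation in the plane of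
  \<open>A\<close> and \<open>B\<close>.\<close>

lemma commutator_R_op_spin:
  assumes A: "A \<in> H2' K" and B: "B \<in> H2' K" and C: "C \<in> H2' K"
  shows "commutator (R_op K A) (R_op K B) C =
    4 *\<^sub>R (spin_form K B C *\<^sub>R A - spin_form K A C *\<^sub>R B)"
proof -
  have H: "A \<in> H2 K" if "A \<in> H2' K" for A using that by (simp add: H2'_def)
  show ?thesis
    by (simp add: commutator_R_op[OF K] H A B C on_space_def jordan_spin jordan_unit
        bilinear_simps[OF bilinear_jordan[OF K]] algebra_simps)
qed

text \<open>Checked through \<open>Der_H2_iff\<close>: at the unit matrix both iterated products are
  twice the product of \<open>A\<close> and \<open>B\<close> and cancel, and on \<open>H2' K\<close>
  the map is the rotation just computed.\<close>

lemma commutator_R_op_Der: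
  assumes A: "A \<in> H2' K" and B: "B \<in> H2' K"
  shows "commutator (R_op K A) (R_op K B) \<in> Der_H2 K"
proof -
  have H: "A \<in> H2 K" if "A \<in> H2' K" for A using that by (simp add: H2'_def)
  note j = bilinear_simps[OF bilinear_jordan[OF K]]
  have R: "R_op K A \<in> endo (H2 K)" if "A \<in> H2' K" for A
    using jordan_in_H2[OF K H[OF that]] H2_subspace(1)[OF K]
    by (auto simp: endo_def R_op_def on_space_def linear_on_def j subspace_add subspace_scale)
  have "commutator (R_op K A) (R_op K B) (unit_mat K) = 0"
    by (simp add: commutator_R_op[OF K] H A B unit_mat_H2 on_space_def jordan_spin jordan_unit j
        spin_form_commute[of B])
  moreover have "commutator (R_op K A) (R_op K B) C \<in> H2' K" if "C \<in> H2' K" for C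
    using commutator_R_op_spin[OF A B that] A B H2_subspace(2)[OF K]
    by (simp add: subspace_diff subspace_scale)
  ultimately show ?thesis
    unfolding Der_H2_iff
    using endo_commutator[OF H2_subspace(1)[OF K] R[OF A] R[OF B]]
    by (auto simp: commutator_R_op_spin A B bilinear_simps[OF spin_form_bilinear]
        spin_form_commute)
qed

end

subsection \<open>The action of the tensors and of the diagonal blocks\<close>

text \<open>A lift is known only on pure tensors, but the preimage of \<open>S\<close> is a subspace
  and hence contains their span. Linear properties of a lift are thus checked on pure
  tensors.\<close>

lemma tensor_lift_in_subspace:
  assumes V: "subspace V" and W: "subspace W" and f: "bilinear_on V W f" and S: "subspace S"
    and fS: "\<And>v w. v \<in> V \<Longrightarrow> w \<in> W \<Longrightarrow> f v w \<in> S" and t: "t \<in> tensor_space V W"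
  shows "tensor_lift V W f t \<in> S"
proof -
  have "tensor_space V W \<subseteq> tensor_lift V W f -` S"
    unfolding tensor_space_def
    by (rule span_minimal)
      (auto simp: tensor_lift(2)[OF V W f] fS intro!: linear_subspace_vimage[OF tensor_lift(1)[OF V W f]] S)
  with t show ?thesis by auto
qed

lemma tensor_in_space: "v \<in> V \<Longrightarrow> w \<in> W \<Longrightarrow> v \<otimes> w \<in> tensor_space V W"
  unfolding tensor_space_def by (rule span_base) blast

lemma subspace_tensor_space: "subspace (tensor_space V W)"
  by (simp add: tensor_space_def)

lemma linear_eq_on_tensor_space:
  assumes "linear f" "linear g" "\<And>v w. v \<in> V \<Longrightarrow> w \<in> W \<Longrightarrow> f (v \<otimes> w) = g (v \<otimes> w)"
    and "t \<in> tensor_space V W"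
  shows "f t = g t"
  by (rule linear_eq_on_span[OF assms(1,2) _ assms(4)[unfolded tensor_space_def]])
    (use assms(3) in auto)

text \<open>The diagonal coordinate goes to the real line of \<open>K2\<close>, so
  \<open>K1 + K2\<close> becomes the orthogonal sum of the image of \<open>H2' K1\<close> and
  \<open>pure K2\<close>. \<open>spin_part\<close> and \<open>pure_part\<close> are the
  corresponding projections.\<close>

definition spin_embed :: "'k::real_vector calg \<Rightarrow> 'l::real_vector calg \<Rightarrow> 'k^2^2 \<Rightarrow> 'k \<times> 'l" where
  "spin_embed K1 K2 A = (fst (spin_coord K1 A), snd (spin_coord K1 A) *\<^sub>R cone K2)"

definition spin_part :: "'k::real_vector calg \<Rightarrow> 'l::real_vector calg \<Rightarrow> 'k \<times> 'l \<Rightarrow> 'k^2^2" where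
  "spin_part K1 K2 u = spin_mat K1 (fst u, re K2 (snd u))"

definition pure_part :: "'l::real_vector calg \<Rightarrow> 'k \<times> 'l \<Rightarrow> 'l" where
  "pure_part K2 u = snd u - re K2 (snd u) *\<^sub>R cone K2"

text \<open>The factor 2 is forced by \<open>mat_inner K1 A B = 4 * spin_form K1 A B\<close>.\<close>

definition mixed_rotation ::
    "'k::real_vector calg \<Rightarrow> 'l::real_vector calg \<Rightarrow> 'k^2^2 \<Rightarrow> 'l \<Rightarrow> 'k \<times> 'l \<Rightarrow> 'k \<times> 'l" where
  "mixed_rotation K1 K2 A w = (\<lambda>u.
     (2 * spin_form K1 A (spin_part K1 K2 u)) *\<^sub>R (0, w) -
     (2 * polar (cnorm K2) w (pure_part K2 u)) *\<^sub>R spin_embed K1 K2 A)"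

definition diagonal_rotation ::
    "'k::real_vector calg \<Rightarrow> 'l::real_vector calg \<Rightarrow> ('k^2^2 \<Rightarrow> 'k^2^2) \<Rightarrow> ('l \<Rightarrow> 'l) \<Rightarrow>
     'k \<times> 'l \<Rightarrow> 'k \<times> 'l" where
  "diagonal_rotation K1 K2 D E = (\<lambda>u.
     spin_embed K1 K2 (D (spin_part K1 K2 u)) + (0, E (pure_part K2 u)))"

definition tensor_rotation ::
    "'k::real_vector calg \<Rightarrow> 'l::real_vector calg \<Rightarrow> ('k^2^2, 'l) tensor \<Rightarrow> 'k \<times> 'l \<Rightarrow> 'k \<times> 'l" where
  "tensor_rotation K1 K2 = tensor_lift (H2' K1) (pure K2) (mixed_rotation K1 K2)"

definition L2_to_so ::
    "'k::real_vector calg \<Rightarrow> 'l::real_vector calg \<Rightarrow> ('k, 'l) L2_vec \<Rightarrow> 'k \<times> 'l \<Rightarrow> 'k \<times> 'l" where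
  "L2_to_so K1 K2 = (\<lambda>(D, t, E). diagonal_rotation K1 K2 D E + tensor_rotation K1 K2 t)"

section \<open>Orthogonal splitting of \<open>K1 + K2\<close> and skewness of the blocks\<close>

context
  fixes K1 :: "'k::real_vector calg" and K2 :: "'l::real_vector calg"
  assumes K1: "composition_algebra K1" and K2: "composition_algebra K2"
begin

private abbreviation "j \<equiv> spin_embed K1 K2"
private abbreviation "m \<equiv> spin_part K1 K2"
private abbreviation p :: "'k \<times> 'l \<Rightarrow> 'l" where "p \<equiv> pure_part K2"
private abbreviation "g \<equiv> spin_form K1"
private abbreviation "P \<equiv> polar (sum_form K1 K2)"
private abbreviation "V \<equiv> H2' K1"
private abbreviation "W \<equiv> pure K2"
private abbreviation "TS \<equiv> tensor_space V W"

lemma subspaces: "subspace V" "subspace W" "subspace (H2 K1)"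
  using H2_subspace[OF K1] calg_pure_subspace[OF K2] by auto

lemma in_H2: "A \<in> V \<Longrightarrow> A \<in> H2 K1"
  by (simp add: H2'_def)

lemma pure_iff: "w \<in> W \<longleftrightarrow> re K2 w = 0"
  by (simp add: pure_def calg_re[OF K2])

lemma polar_sum: "P u v = polar (cnorm K1) (fst u) (fst v) + polar (cnorm K2) (snd u) (snd v)"
  by (cases u; cases v) (simp add: polar_def sum_form_def field_simps)

lemma bilinear_P: "bilinear P"
  unfolding bilinear_def polar_sum
  by (intro conjI allI linearI)
    (simp_all add: calg_polar_simps[OF K1] calg_polar_simps[OF K2] algebra_simps)

lemma linear_parts: "linear j" "linear m" "linear p"
proof -
  show "linear j"
    by (rule linearI)
      (simp_all add: spin_embed_def linear_add[OF linear_spin_coord[OF K1]]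
        linear_scale[OF linear_spin_coord[OF K1]] algebra_simps)
  show "linear m"
    by (rule linearI)
      (simp_all add: spin_part_def re_simps[OF K2] linear_add[OF linear_spin_mat[OF K1], symmetric]
        linear_scale[OF linear_spin_mat[OF K1], symmetric])
  show "linear p"
    by (rule linearI) (simp_all add: pure_part_def re_simps[OF K2] algebra_simps)
qed

lemmas parts_simps = linear_parts[THEN linear_add] linear_parts[THEN linear_scale] linear_parts[THEN linear_0]
  linear_parts[THEN linear_diff] linear_parts[THEN linear_neg]

lemma parts:
  shows m_j: "A \<in> V \<Longrightarrow> m (j A) = A" and m_pure: "w \<in> W \<Longrightarrow> m (0, w) = 0"
    and p_j: "p (j A) = 0" and p_pure: "w \<in> W \<Longrightarrow> p (0, w) = w"
    and m_in: "m u \<in> V" and p_in: "p u \<in> W"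
    and parts_split: "j (m u) + (0, p u) = u" and j_unit: "j (unit_mat K1) = 0"
  using H2'_eq[OF K1, of A] linear_0[OF linear_spin_mat[OF K1]]
  by (auto simp: spin_embed_def spin_part_def pure_part_def re_simps[OF K2] pure_iff zero_prod_def
      spin_mat_H2'[OF K1] spin_coord_mat[OF K1] spin_coord_unit[OF K1] prod_eq_iff)

text \<open>Adjointness of \<open>j\<close> and \<open>m\<close>. With \<open>P_pure\<close> it
  reduces pairings on \<open>K1 + K2\<close> to pairings on the two summands.\<close>

lemma P_j: "P (j A) u = g A (m u)" "P u (j A) = g (m u) A"
  by (simp_all add: polar_sum spin_form_def spin_embed_def spin_part_def spin_coord_mat[OF K1]
      calg_polar_simps[OF K2] calg_re[OF K2] polar_commute)

lemma P_pure: "w \<in> W \<Longrightarrow> P (0, w) u = polar (cnorm K2) w (p u)"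
  "w \<in> W \<Longrightarrow> P u (0, w) = polar (cnorm K2) (p u) w"
  by (simp_all add: polar_sum pure_part_def calg_polar_simps[OF K2] calg_polar_simps[OF K1]
      pure_def polar_commute)

lemmas form_simps = bilinear_simps[OF spin_form_bilinear[OF K1]] bilinear_simps[OF calg_polar_bilinear[OF K2]]

lemma bilinear_on_mixed: "bilinear_on V W (mixed_rotation K1 K2)"
  by (auto simp: bilinear_on_def linear_on_def mixed_rotation_def fun_eq_iff scaleR_fun_def
      parts_simps form_simps algebra_simps prod_eq_iff)

lemma tensor_rotation:
  shows linear_tensor_rotation: "linear (tensor_rotation K1 K2)"
    and tensor_rotation_pure: "A \<in> V \<Longrightarrow> w \<in> W \<Longrightarrow> tensor_rotation K1 K2 (A \<otimes> w) = mixed_rotation K1 K2 A w"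
  unfolding tensor_rotation_def
  using tensor_lift[OF subspaces(1,2) bilinear_on_mixed] by auto

lemma so_sum_iff: "T \<in> carrier (so UNIV (sum_form K1 K2)) \<longleftrightarrow>
    linear T \<and> (\<forall>u v. P (T u) v = - P u (T v))"
  by (auto simp: so_iff endo_def linear_on_def linear_iff)

text \<open>By adjointness this map sends \<open>u\<close> to twice \<open>P (j A) u\<close> times
  \<open>(0, w)\<close> minus twice \<open>P (0, w) u\<close> times \<open>j A\<close>, the standard
  skew map attached to two vectors.\<close>

lemma mixed_rotation_so:
  assumes "A \<in> V" "w \<in> W"
  shows "mixed_rotation K1 K2 A w \<in> carrier (so UNIV (sum_form K1 K2))"
  unfolding so_sum_iff
proof (intro conjI allI)
  show "linear (mixed_rotation K1 K2 A w)"
    by (rule linearI) (simp_all add: mixed_rotation_def parts_simps form_simps algebra_simps prod_eq_iff)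
  show "P (mixed_rotation K1 K2 A w u) v = - P u (mixed_rotation K1 K2 A w v)" for u v
    using assms
    by (simp add: mixed_rotation_def bilinear_simps[OF bilinear_P] P_j P_pure
        spin_form_commute[OF K1, of _ A] polar_commute[of _ _ w] del: scaleR_Pair)
qed

lemma tensor_rotation_so:
  assumes "t \<in> TS"
  shows "tensor_rotation K1 K2 t \<in> carrier (so UNIV (sum_form K1 K2))"
  unfolding tensor_rotation_def
  by (rule tensor_lift_in_subspace[OF subspaces(1,2) bilinear_on_mixed
        subspace_so[OF subspace_UNIV bilinear_P] mixed_rotation_so assms])

lemma linear_tensor_rotation_value: "t \<in> TS \<Longrightarrow> linear (tensor_rotation K1 K2 t)"
  using tensor_rotation_so so_sum_iff by blast

text \<open>Mixed rotations exchange the two summands, and this is a linear condition. It lets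
  \<open>D\<close> and \<open>E\<close> be read off from the diagonal blocks.\<close>

lemma tensor_rotation_offdiagonal:
  assumes t: "t \<in> TS"
  shows "m (tensor_rotation K1 K2 t (j A)) = 0" "w \<in> W \<Longrightarrow> p (tensor_rotation K1 K2 t (0, w)) = 0"
proof -
  let ?S = "{T. (\<forall>A. m (T (j A)) = 0) \<and> (\<forall>w\<in>W. p (T (0, w)) = 0)}"
  have "tensor_rotation K1 K2 t \<in> ?S"
    unfolding tensor_rotation_def
  proof (rule tensor_lift_in_subspace[OF subspaces(1,2) bilinear_on_mixed _ _ t])
    show "subspace ?S" by (auto simp: subspace_def parts_simps scaleR_fun_def)
    show "mixed_rotation K1 K2 A w \<in> ?S" if "A \<in> V" "w \<in> W" for A w
      using that by (auto simp: mixed_rotation_def parts_simps form_simps p_j m_pure simp del: scaleR_Pair)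
  qed
  then show "m (tensor_rotation K1 K2 t (j A)) = 0" "w \<in> W \<Longrightarrow> p (tensor_rotation K1 K2 t (0, w)) = 0"
    by auto
qed

lemma Der_facts:
  assumes "D \<in> Der_H2 K1"
  shows "A \<in> H2 K1 \<Longrightarrow> B \<in> H2 K1 \<Longrightarrow> D (A + B) = D A + D B" "A \<in> H2 K1 \<Longrightarrow> D (c *\<^sub>R A) = c *\<^sub>R D A"
    "A \<in> V \<Longrightarrow> D A \<in> V" "A \<in> V \<Longrightarrow> B \<in> V \<Longrightarrow> g (D A) B = - g A (D B)" "D 0 = 0" "linear_on V D"
proof -
  have D: "D \<in> endo (H2 K1)" "\<forall>A\<in>V. D A \<in> V" "\<forall>A\<in>V. \<forall>B\<in>V. g (D A) B = - g A (D B)"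
    using assms unfolding Der_H2_iff[OF K1] by auto
  show "A \<in> H2 K1 \<Longrightarrow> B \<in> H2 K1 \<Longrightarrow> D (A + B) = D A + D B" "A \<in> H2 K1 \<Longrightarrow> D (c *\<^sub>R A) = c *\<^sub>R D A"
    "A \<in> V \<Longrightarrow> D A \<in> V" "A \<in> V \<Longrightarrow> B \<in> V \<Longrightarrow> g (D A) B = - g A (D B)" "D 0 = 0" "linear_on V D"
    using D endoD(1)[OF D(1)] in_H2 linear_on_0[OF endoD(1)[OF D(1)] subspace_0[OF subspaces(3)]]
    by (auto simp: linear_on_def)
qed

lemma so_pure_facts:
  assumes "E \<in> carrier (so W (cnorm K2))"
  shows "x \<in> W \<Longrightarrow> y \<in> W \<Longrightarrow> E (x + y) = E x + E y" "x \<in> W \<Longrightarrow> E (c *\<^sub>R x) = c *\<^sub>R E x"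
    "x \<in> W \<Longrightarrow> E x \<in> W" "x \<in> W \<Longrightarrow> y \<in> W \<Longrightarrow> polar (cnorm K2) (E x) y = - polar (cnorm K2) x (E y)"
    "E 0 = 0" "linear_on W E"
proof -
  have E: "E \<in> endo W" using assms by (simp add: so_iff)
  show "x \<in> W \<Longrightarrow> y \<in> W \<Longrightarrow> E (x + y) = E x + E y" "x \<in> W \<Longrightarrow> E (c *\<^sub>R x) = c *\<^sub>R E x"
    "x \<in> W \<Longrightarrow> E x \<in> W" "x \<in> W \<Longrightarrow> y \<in> W \<Longrightarrow> polar (cnorm K2) (E x) y = - polar (cnorm K2) x (E y)"
    "E 0 = 0" "linear_on W E"
    using E assms endoD[OF E] linear_on_0[OF endoD(1)[OF E] subspace_0[OF subspaces(2)]]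
    by (auto simp: linear_on_def so_iff)
qed

lemma linear_diagonal_rotation:
  assumes "D \<in> Der_H2 K1" "E \<in> carrier (so W (cnorm K2))"
  shows "linear (diagonal_rotation K1 K2 D E)"
  by (rule linearI)
    (simp_all add: diagonal_rotation_def parts_simps Der_facts[OF assms(1)] so_pure_facts[OF assms(2)]
      in_H2 m_in p_in algebra_simps prod_eq_iff)

lemma diagonal_rotation_so:
  assumes "D \<in> Der_H2 K1" "E \<in> carrier (so W (cnorm K2))"
  shows "diagonal_rotation K1 K2 D E \<in> carrier (so UNIV (sum_form K1 K2))"
  unfolding so_sum_iff
  using linear_diagonal_rotation[OF assms] Der_facts[OF assms(1)] so_pure_facts[OF assms(2)]
  by (simp add: diagonal_rotation_def bilinear_simps[OF bilinear_P] P_j P_pure m_in p_in)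

section \<open>Brackets of the diagonal part with tensors\<close>

lemma L2_act_bilinear:
  assumes "D \<in> Der_H2 K1" "E \<in> carrier (so W (cnorm K2))"
  shows "bilinear_on V W (\<lambda>A x. D A \<otimes> x + A \<otimes> E x)"
  using Der_facts(6)[OF assms(1)] so_pure_facts(6)[OF assms(2)]
  by (simp add: bilinear_on_def linear_on_def tensor_simps algebra_simps)

lemma L2_act_in:
  assumes "D \<in> Der_H2 K1" "E \<in> carrier (so W (cnorm K2))" "t \<in> TS"
  shows "L2_act K1 K2 D E t \<in> TS"
  unfolding L2_act_def
  by (rule tensor_lift_in_subspace[OF subspaces(1,2) L2_act_bilinear[OF assms(1,2)] subspace_tensor_space _ assms(3)])
    (simp add: subspace_add[OF subspace_tensor_space] tensor_in_space Der_facts[OF assms(1)]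
      so_pure_facts[OF assms(2)])

text \<open>By linearity in \<open>t\<close> only pure tensors matter. There the commutator of a
  skew map with the skew map of two vectors applies it to each of the two vectors in turn, which is
  the Leibniz rule of \<open>L2_act\<close>.\<close>

lemma tensor_rotation_act:
  assumes D: "D \<in> Der_H2 K1" and E: "E \<in> carrier (so W (cnorm K2))" and t: "t \<in> TS"
  shows "tensor_rotation K1 K2 (L2_act K1 K2 D E t) =
    commutator (diagonal_rotation K1 K2 D E) (tensor_rotation K1 K2 t)"
proof (rule linear_eq_on_tensor_space[OF _ _ _ t])
  note act = tensor_lift[OF subspaces(1,2) L2_act_bilinear[OF D E], folded L2_act_def]
  note dl = linear_diagonal_rotation[OF D E]
  show "linear (\<lambda>t. tensor_rotation K1 K2 (L2_act K1 K2 D E t))"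
    using linear_compose[OF act(1) linear_tensor_rotation] by (simp add: o_def)
  show "linear (\<lambda>t. commutator (diagonal_rotation K1 K2 D E) (tensor_rotation K1 K2 t))"
    by (rule linearI; simp only: linear_add[OF linear_tensor_rotation] linear_scale[OF linear_tensor_rotation])
      (simp_all add: commutator_def fun_eq_iff scaleR_fun_def linear_add[OF dl] linear_scale[OF dl]
        algebra_simps)
  fix A x assume h: "A \<in> V" "x \<in> W"
  show "tensor_rotation K1 K2 (L2_act K1 K2 D E (A \<otimes> x)) =
    commutator (diagonal_rotation K1 K2 D E) (tensor_rotation K1 K2 (A \<otimes> x))"
  proof
    fix u
    have 1: "tensor_rotation K1 K2 (L2_act K1 K2 D E (A \<otimes> x)) =
        mixed_rotation K1 K2 (D A) x + mixed_rotation K1 K2 A (E x)"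
      by (simp add: act(2) h linear_add[OF linear_tensor_rotation] tensor_rotation_pure
          Der_facts[OF D] so_pure_facts[OF E])
    have 2: "diagonal_rotation K1 K2 D E (0, x) = (0, E x)" "diagonal_rotation K1 K2 D E (j A) = j (D A)"
      by (simp_all add: zero_prod_def[symmetric] diagonal_rotation_def h m_pure p_pure p_j m_j Der_facts[OF D]
          so_pure_facts[OF E] parts_simps)
    \<comment> \<open>The projections intertwine the diagonal rotation with \<open>D\<close> and
      \<open>E\<close>; skewness then moves these onto \<open>A\<close> and
      \<open>x\<close>.\<close>
    have 3: "m (diagonal_rotation K1 K2 D E u) = D (m u)" "p (diagonal_rotation K1 K2 D E u) = E (p u)"
      by (simp_all add: diagonal_rotation_def parts_simps m_j m_pure p_pure p_j Der_facts[OF D]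
          so_pure_facts[OF E] m_in p_in)
    show "tensor_rotation K1 K2 (L2_act K1 K2 D E (A \<otimes> x)) u =
        commutator (diagonal_rotation K1 K2 D E) (tensor_rotation K1 K2 (A \<otimes> x)) u"
      unfolding 1 commutator_def tensor_rotation_pure[OF h]
      by (simp add: mixed_rotation_def linear_diff[OF dl] linear_scale[OF dl] 2 3
          Der_facts(4)[OF D h(1) m_in] so_pure_facts(4)[OF E h(2) p_in] del: scaleR_Pair)
  qed
qed

section \<open>Brackets of two tensors\<close>

text \<open>Bilinearity in either pair of arguments with the other pair fixed, the two conditions
  under which \<open>bilinear_on_tensor_lift\<close> makes the nested lift meaningful.\<close>

lemma Der_bracket_bilinear:
  assumes "A \<in> V" "x \<in> W"
  shows "bilinear_on V W (\<lambda>B y. - (cinner K2 x y *\<^sub>R commutator (R_op K1 A) (R_op K1 B)))"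
    and "bilinear_on V W (\<lambda>B y. - (cinner K2 y x *\<^sub>R commutator (R_op K1 B) (R_op K1 A)))"
  using assms(1) subspaces(1)
  by (auto simp: bilinear_on_def linear_on_def commutator_R_op[OF K1] in_H2 on_space_def subspace_add
      subspace_scale fun_eq_iff scaleR_fun_def calg_cinner[OF K2] bilinear_simps[OF bilinear_jordan[OF K1]]
      form_simps algebra_simps)

lemma so_bracket_bilinear:
  assumes "A \<in> V" "x \<in> W"
  shows "bilinear_on V W (\<lambda>B y. mat_inner K1 A B *\<^sub>R S_op K2 x y)"
    and "bilinear_on V W (\<lambda>B y. mat_inner K1 B A *\<^sub>R S_op K2 y x)"
  using assms(1) subspaces(1)
  by (auto simp: bilinear_on_def linear_on_def mat_inner_spin[OF K1] S_op_def on_space_def subspace_add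
      subspace_scale fun_eq_iff scaleR_fun_def calg_cinner[OF K2] form_simps algebra_simps)

text \<open>The nested lift is unfolded one argument at a time: a pure tensor on the left leaves a
  single lift on the right. Membership in \<open>Der_H2 K1\<close> passes through both lifts because
  it is a linear condition.\<close>

lemma Der_bracket:
  assumes u: "u \<in> TS"
  shows "linear (\<lambda>t. L2_tensor_bracket_Der K1 K2 t u)"
    and "A \<in> V \<Longrightarrow> x \<in> W \<Longrightarrow> L2_tensor_bracket_Der K1 K2 (A \<otimes> x) u =
      tensor_lift V W (\<lambda>B y. - (cinner K2 x y *\<^sub>R commutator (R_op K1 A) (R_op K1 B))) u"
    and "t \<in> TS \<Longrightarrow> L2_tensor_bracket_Der K1 K2 t u \<in> Der_H2 K1"
proof -
  note b = bilinear_on_tensor_lift[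
      where F = "\<lambda>A x B y. - (cinner K2 x y *\<^sub>R commutator (R_op K1 A) (R_op K1 B))",
      OF subspaces(1,2) Der_bracket_bilinear u]
  show "linear (\<lambda>t. L2_tensor_bracket_Der K1 K2 t u)"
    unfolding L2_tensor_bracket_Der_def by (rule tensor_lift(1)[OF subspaces(1,2) b])
  show "A \<in> V \<Longrightarrow> x \<in> W \<Longrightarrow> L2_tensor_bracket_Der K1 K2 (A \<otimes> x) u =
      tensor_lift V W (\<lambda>B y. - (cinner K2 x y *\<^sub>R commutator (R_op K1 A) (R_op K1 B))) u"
    unfolding L2_tensor_bracket_Der_def by (rule tensor_lift(2)[OF subspaces(1,2) b])
  show "L2_tensor_bracket_Der K1 K2 t u \<in> Der_H2 K1" if t: "t \<in> TS"
    unfolding L2_tensor_bracket_Der_def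
  proof (rule tensor_lift_in_subspace[OF subspaces(1,2) b subspace_Der_H2[OF K1] _ t])
    fix A x assume Ax: "A \<in> V" "x \<in> W"
    show "tensor_lift V W (\<lambda>B y. - (cinner K2 x y *\<^sub>R commutator (R_op K1 A) (R_op K1 B))) u \<in> Der_H2 K1"
      by (rule tensor_lift_in_subspace[OF subspaces(1,2) Der_bracket_bilinear(1)[OF Ax] subspace_Der_H2[OF K1] _ u])
        (intro subspace_neg subspace_scale subspace_Der_H2[OF K1] commutator_R_op_Der[OF K1] Ax)
  qed
qed

lemma S_op_so:
  assumes "x \<in> W" "y \<in> W"
  shows "S_op K2 x y \<in> carrier (so W (cnorm K2))"
  using assms subspaces(2)
  by (auto simp: so_iff endo_def linear_on_def S_op_def on_space_def subspace_add subspace_scale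
      subspace_diff calg_cinner[OF K2] form_simps algebra_simps polar_commute)

lemma so_bracket:
  assumes u: "u \<in> TS"
  shows "linear (\<lambda>t. L2_tensor_bracket_so K1 K2 t u)"
    and "A \<in> V \<Longrightarrow> x \<in> W \<Longrightarrow> L2_tensor_bracket_so K1 K2 (A \<otimes> x) u =
      tensor_lift V W (\<lambda>B y. mat_inner K1 A B *\<^sub>R S_op K2 x y) u"
    and "t \<in> TS \<Longrightarrow> L2_tensor_bracket_so K1 K2 t u \<in> carrier (so W (cnorm K2))"
proof -
  note b = bilinear_on_tensor_lift[where F = "\<lambda>A x B y. mat_inner K1 A B *\<^sub>R S_op K2 x y",
      OF subspaces(1,2) so_bracket_bilinear u]
  note sub = subspace_so[OF subspaces(2) calg_polar_bilinear[OF K2]]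
  show "linear (\<lambda>t. L2_tensor_bracket_so K1 K2 t u)"
    unfolding L2_tensor_bracket_so_def by (rule tensor_lift(1)[OF subspaces(1,2) b])
  show "A \<in> V \<Longrightarrow> x \<in> W \<Longrightarrow> L2_tensor_bracket_so K1 K2 (A \<otimes> x) u =
      tensor_lift V W (\<lambda>B y. mat_inner K1 A B *\<^sub>R S_op K2 x y) u"
    unfolding L2_tensor_bracket_so_def by (rule tensor_lift(2)[OF subspaces(1,2) b])
  show "L2_tensor_bracket_so K1 K2 t u \<in> carrier (so W (cnorm K2))" if t: "t \<in> TS"
    unfolding L2_tensor_bracket_so_def
  proof (rule tensor_lift_in_subspace[OF subspaces(1,2) b sub _ t])
    fix A x assume Ax: "A \<in> V" "x \<in> W"
    show "tensor_lift V W (\<lambda>B y. mat_inner K1 A B *\<^sub>R S_op K2 x y) u \<in> carrier (so W (cnorm K2))"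
      by (rule tensor_lift_in_subspace[OF subspaces(1,2) so_bracket_bilinear(1)[OF Ax] sub _ u])
        (intro subspace_scale sub S_op_so Ax)
  qed
qed

lemma linear_diagonal_in_args:
  "diagonal_rotation K1 K2 (D + D') (E + E') = diagonal_rotation K1 K2 D E + diagonal_rotation K1 K2 D' E'"
  "diagonal_rotation K1 K2 (c *\<^sub>R D) (c *\<^sub>R E) = c *\<^sub>R diagonal_rotation K1 K2 D E"
  by (auto simp: diagonal_rotation_def fun_eq_iff parts_simps scaleR_fun_def algebra_simps prod_eq_iff)

text \<open>The commutator of two mixed rotations is block diagonal: pairing \<open>x\<close> with
  \<open>y\<close> leaves a rotation in the plane of \<open>A\<close> and \<open>B\<close>, and
  pairing \<open>A\<close> with \<open>B\<close> leaves one in the plane of \<open>x\<close> and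
  \<open>y\<close>. The two factors 2 multiply to the 4 of \<open>commutator_R_op_spin\<close> and
  of \<open>mat_inner_spin\<close>.\<close>

lemma mixed_rotation_commutator:
  assumes h: "A \<in> V" "x \<in> W" "B \<in> V" "y \<in> W"
  shows "diagonal_rotation K1 K2 (- (cinner K2 x y *\<^sub>R commutator (R_op K1 A) (R_op K1 B)))
      (mat_inner K1 A B *\<^sub>R S_op K2 x y) =
    commutator (mixed_rotation K1 K2 A x) (mixed_rotation K1 K2 B y)"
  using h m_in p_in subspace_scale[OF subspaces(2) h(2)] subspace_scale[OF subspaces(2) h(4)]
  \<comment> \<open>Only this commutator is unfolded; the one of the multiplications must stay
    intact for \<open>commutator_R_op_spin\<close>.\<close>
  unfolding commutator_def[of "mixed_rotation K1 K2 A x"]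
  by (simp add: fun_eq_iff diagonal_rotation_def
      mixed_rotation_def commutator_R_op_spin[OF K1] mat_inner_spin[OF K1] S_op_def on_space_def
      scaleR_fun_def calg_cinner[OF K2] parts_simps form_simps m_j m_pure p_j p_pure
      spin_form_commute[OF K1, of B A] polar_commute[of _ y x] algebra_simps prod_eq_iff)

text \<open>Both sides are linear in \<open>t\<close> and in \<open>u\<close>, so the identity is
  reduced to pure tensors first on the left and then on the right.\<close>

lemma tensor_rotation_commutator:
  assumes t: "t \<in> TS" and u: "u \<in> TS"
  shows "diagonal_rotation K1 K2 (L2_tensor_bracket_Der K1 K2 t u) (L2_tensor_bracket_so K1 K2 t u) =
    commutator (tensor_rotation K1 K2 t) (tensor_rotation K1 K2 u)"
proof (rule linear_eq_on_tensor_space[OF _ _ _ t])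
  note lt = linear_tensor_rotation
  note lu = linear_tensor_rotation_value[OF u]
  show "linear (\<lambda>t. diagonal_rotation K1 K2 (L2_tensor_bracket_Der K1 K2 t u) (L2_tensor_bracket_so K1 K2 t u))"
    by (rule linearI)
      (simp_all add: linear_add[OF Der_bracket(1)[OF u]] linear_scale[OF Der_bracket(1)[OF u]]
        linear_add[OF so_bracket(1)[OF u]] linear_scale[OF so_bracket(1)[OF u]] linear_diagonal_in_args)
  show "linear (\<lambda>t. commutator (tensor_rotation K1 K2 t) (tensor_rotation K1 K2 u))"
    by (rule linearI; simp only: linear_add[OF lt] linear_scale[OF lt])
      (simp_all add: commutator_def fun_eq_iff scaleR_fun_def linear_add[OF lu] linear_scale[OF lu] algebra_simps)
  fix A x assume A: "A \<in> V" and x: "x \<in> W"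
  note dl = tensor_lift[OF subspaces(1,2) Der_bracket_bilinear(1)[OF A x]]
  note sl = tensor_lift[OF subspaces(1,2) so_bracket_bilinear(1)[OF A x]]
  have lm: "linear (mixed_rotation K1 K2 A x)"
    using mixed_rotation_so[OF A x] so_sum_iff by blast
  show "diagonal_rotation K1 K2 (L2_tensor_bracket_Der K1 K2 (A \<otimes> x) u)
      (L2_tensor_bracket_so K1 K2 (A \<otimes> x) u) =
    commutator (tensor_rotation K1 K2 (A \<otimes> x)) (tensor_rotation K1 K2 u)"
    unfolding Der_bracket(2)[OF u A x] so_bracket(2)[OF u A x] tensor_rotation_pure[OF A x]
  proof (rule linear_eq_on_tensor_space[OF _ _ _ u])
    show "linear (\<lambda>u. diagonal_rotation K1 K2
        (tensor_lift V W (\<lambda>B y. - (cinner K2 x y *\<^sub>R commutator (R_op K1 A) (R_op K1 B))) u)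
        (tensor_lift V W (\<lambda>B y. mat_inner K1 A B *\<^sub>R S_op K2 x y) u))"
      by (rule linearI)
        (simp_all add: linear_add[OF dl(1)] linear_scale[OF dl(1)]
          linear_add[OF sl(1)] linear_scale[OF sl(1)] linear_diagonal_in_args)
    show "linear (\<lambda>u. commutator (mixed_rotation K1 K2 A x) (tensor_rotation K1 K2 u))"
      by (rule linearI; simp only: linear_add[OF lt] linear_scale[OF lt])
        (simp_all add: commutator_def fun_eq_iff scaleR_fun_def linear_add[OF lm] linear_scale[OF lm] algebra_simps)
    fix B y assume B: "B \<in> V" and y: "y \<in> W"
    show "diagonal_rotation K1 K2
        (tensor_lift V W (\<lambda>B y. - (cinner K2 x y *\<^sub>R commutator (R_op K1 A) (R_op K1 B))) (B \<otimes> y))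
        (tensor_lift V W (\<lambda>B y. mat_inner K1 A B *\<^sub>R S_op K2 x y) (B \<otimes> y)) =
      commutator (mixed_rotation K1 K2 A x) (tensor_rotation K1 K2 (B \<otimes> y))"
      unfolding dl(2)[OF B y] sl(2)[OF B y] tensor_rotation_pure[OF B y]
      by (rule mixed_rotation_commutator[OF A x B y])
  qed
qed

lemma diagonal_rotation_commutator:
  assumes D: "D \<in> Der_H2 K1" "D' \<in> Der_H2 K1"
    and E: "E \<in> carrier (so W (cnorm K2))" "E' \<in> carrier (so W (cnorm K2))"
  shows "diagonal_rotation K1 K2 (commutator D D') (commutator E E') =
    commutator (diagonal_rotation K1 K2 D E) (diagonal_rotation K1 K2 D' E')"
  using Der_facts[OF D(1)] Der_facts[OF D(2)] so_pure_facts[OF E(1)] so_pure_facts[OF E(2)]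
  by (simp add: fun_eq_iff diagonal_rotation_def commutator_def parts_simps m_j m_pure p_j p_pure m_in p_in)

section \<open>The homomorphism from \<open>L2\<close> to the orthogonal algebra\<close>

lemma L2_carrier:
  "carrier (L2 K1 K2) = Der_H2 K1 \<times> TS \<times> carrier (so W (cnorm K2))"
  by (simp add: L2_def)

lemma subspace_L2: "subspace (carrier (L2 K1 K2))"
  unfolding L2_carrier
  by (intro subspace_Times subspace_Der_H2[OF K1] subspace_tensor_space
      subspace_so[OF subspaces(2) calg_polar_bilinear[OF K2]])

lemma L2_closed:
  assumes "X \<in> carrier (L2 K1 K2)" "Y \<in> carrier (L2 K1 K2)"
  shows "bracket (L2 K1 K2) X Y \<in> carrier (L2 K1 K2)"
  using assms
  by (auto simp: L2_def intro!: subspace_add subspace_diff subspace_Der_H2[OF K1] subspace_tensor_space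
      subspace_so[OF subspaces(2) calg_polar_bilinear[OF K2]] Der_H2_commutator[OF K1] Der_bracket(3)
      so_bracket(3) L2_act_in so_commutator[OF subspaces(2) calg_polar_bilinear[OF K2]])

lemma L2_to_so_hom:
  assumes "X \<in> carrier (L2 K1 K2)" "Y \<in> carrier (L2 K1 K2)"
  shows "L2_to_so K1 K2 (bracket (L2 K1 K2) X Y) = commutator (L2_to_so K1 K2 X) (L2_to_so K1 K2 Y)"
proof -
  obtain D t E D' t' E' where XY: "X = (D, t, E)" "Y = (D', t', E')"
    by (metis surj_pair)
  have h: "D \<in> Der_H2 K1" "t \<in> TS" "E \<in> carrier (so W (cnorm K2))"
    "D' \<in> Der_H2 K1" "t' \<in> TS" "E' \<in> carrier (so W (cnorm K2))"
    using assms by (auto simp: XY L2_carrier)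
  let ?d = "diagonal_rotation K1 K2" and ?\<tau> = "tensor_rotation K1 K2"
  \<comment> \<open>The mixed terms are grouped as a difference to match the tensor component of the
    bracket of \<open>L2\<close>.\<close>
  have add: "commutator (S + T) (S' + T') = commutator S S' + commutator T T' +
      (commutator S T' - commutator S' T)"
    if "linear S" "linear T" "linear S'" "linear T'" for S T S' T' :: "'k \<times> 'l \<Rightarrow> 'k \<times> 'l"
    using that[THEN linear_add] by (simp add: commutator_def fun_eq_iff)
  have "L2_to_so K1 K2 (bracket (L2 K1 K2) X Y) =
      ?d (commutator D D') (commutator E E') +
      ?d (L2_tensor_bracket_Der K1 K2 t t') (L2_tensor_bracket_so K1 K2 t t') +
      (?\<tau> (L2_act K1 K2 D E t') - ?\<tau> (L2_act K1 K2 D' E' t))"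
    by (simp add: XY L2_def L2_to_so_def linear_diagonal_in_args linear_diff[OF linear_tensor_rotation])
  also have "\<dots> = commutator (?d D E + ?\<tau> t) (?d D' E' + ?\<tau> t')"
    unfolding add[OF linear_diagonal_rotation[OF h(1,3)] linear_tensor_rotation_value[OF h(2)]
      linear_diagonal_rotation[OF h(4,6)] linear_tensor_rotation_value[OF h(5)]]
    by (simp only: h diagonal_rotation_commutator tensor_rotation_commutator tensor_rotation_act)
  finally show ?thesis by (simp add: XY L2_to_so_def)
qed

lemma linear_L2_to_so: "linear_on C (L2_to_so K1 K2)"
  by (auto simp: linear_on_def L2_to_so_def linear_diagonal_in_args scaleR_add_right
      linear_add[OF linear_tensor_rotation] linear_scale[OF linear_tensor_rotation])

lemma L2_to_so_in:
  assumes "X \<in> carrier (L2 K1 K2)"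
  shows "L2_to_so K1 K2 X \<in> carrier (so UNIV (sum_form K1 K2))"
  using assms
  by (auto simp: L2_carrier L2_to_so_def intro!: subspace_add[OF subspace_so[OF subspace_UNIV bilinear_P]]
      diagonal_rotation_so tensor_rotation_so)

section \<open>Bijectivity of the homomorphism\<close>

text \<open>The frame of \<open>K1\<close> is carried over by \<open>spin_mat\<close> and completed
  by the diagonal matrix with entries 1 and -1, whose norm is 1; hence \<open>Suc (s + t)\<close>
  vectors.\<close>

lemma spin_frame:
  assumes b: "orthonormal_frame (cnorm K1) s t b"
  shows "\<exists>(n::nat) e c. (\<forall>i. c i \<in> V) \<and> (\<forall>A\<in>V. (\<Sum>i<n. (e i * g A (c i)) *\<^sub>R c i) = A)"
proof -
  let ?c = "\<lambda>i. spin_mat K1 (if i < s + t then (b i, 0) else (0, 1))"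
  let ?e = "\<lambda>i. if i < s + t then frame_sign s i else 1"
  note ls = linear_spin_mat[OF K1]
  have expansion: "(\<Sum>i<Suc (s + t). (?e i * g A (?c i)) *\<^sub>R ?c i) = A" if A: "A \<in> V" for A
  proof -
    obtain x r where xr: "A = spin_mat K1 (x, r)" using H2'_eq[OF K1 A] by (metis surj_pair)
    have gx: "g A (spin_mat K1 (y, q)) = polar (cnorm K1) x y + r * q" for y q
      by (simp add: xr spin_form_def spin_coord_mat[OF K1])
    have l1: "linear (\<lambda>y. spin_mat K1 (y, 0))"
      using linear_compose[OF _ ls, of "\<lambda>y. (y, 0)"] by (simp add: o_def linear_iff)
    have "(\<Sum>i<s + t. (?e i * g A (?c i)) *\<^sub>R ?c i) =
        (\<Sum>i<s + t. spin_mat K1 ((frame_sign s i * polar (cnorm K1) x (b i)) *\<^sub>R b i, 0))"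
      by (intro sum.cong) (simp_all add: gx linear_scale[OF l1])
    also have "\<dots> = spin_mat K1 (\<Sum>i<s + t. (frame_sign s i * polar (cnorm K1) x (b i)) *\<^sub>R b i, 0)"
      by (simp add: linear_sum[OF l1])
    also have "(\<Sum>i<s + t. (frame_sign s i * polar (cnorm K1) x (b i)) *\<^sub>R b i) = x"
      using b unfolding orthonormal_frame_def by metis
    finally have "(\<Sum>i<Suc (s + t). (?e i * g A (?c i)) *\<^sub>R ?c i) =
        spin_mat K1 (x, 0) + r *\<^sub>R spin_mat K1 (0, 1)"
      by (simp add: gx calg_polar_simps[OF K1])
    also have "\<dots> = A"
      by (simp add: xr linear_add[OF ls, symmetric] linear_scale[OF ls, symmetric])
    finally show ?thesis .
  qed
  show ?thesis
    by (rule exI[of _ "Suc (s + t)"], rule exI[of _ ?e], rule exI[of _ ?c])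
      (intro conjI allI ballI spin_mat_H2'[OF K1] expansion)
qed

lemma bij_L2_to_so:
  assumes b: "orthonormal_frame (cnorm K1) s t b"
  shows "bij_betw (L2_to_so K1 K2) (carrier (L2 K1 K2)) (carrier (so UNIV (sum_form K1 K2)))"
proof -
  obtain n :: nat and e c
    where c: "(\<forall>i. c i \<in> V) \<and> (\<forall>A\<in>V. (\<Sum>i<n. (e i * g A (c i)) *\<^sub>R c i) = A)"
    using spin_frame[OF b] by blast
  then have cV: "c i \<in> V" and cA: "A \<in> V \<Longrightarrow> (\<Sum>i<n. (e i * g A (c i)) *\<^sub>R c i) = A" for i A
    by auto
  \<comment> \<open>For \<open>T\<close> the rotation of \<open>A \<otimes> w\<close>, the vector
    \<open>p (T (j (c i)))\<close> is \<open>2 * g A (c i)\<close> times \<open>w\<close>. Halving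
    and expanding \<open>A\<close> in the frame gives back \<open>A \<otimes> w\<close>.\<close>
  define \<sigma> where "\<sigma> T = (\<Sum>i<n. (e i / 2) *\<^sub>R (c i \<otimes> p (T (j (c i)))))" for T :: "'k \<times> 'l \<Rightarrow> 'k \<times> 'l"
  \<comment> \<open>The candidate inverse reads off three blocks of \<open>T\<close>: both diagonal
    ones and the one from \<open>H2' K1\<close> to \<open>pure K2\<close>.\<close>
  define \<psi> where "\<psi> T = (on_space (H2 K1) (\<lambda>A. m (T (j A))), \<sigma> T, on_space W (\<lambda>w. p (T (0, w))))"
    for T :: "'k \<times> 'l \<Rightarrow> 'k \<times> 'l"
  let ?C = "carrier (L2 K1 K2)" and ?S = "carrier (so UNIV (sum_form K1 K2))"
  have "(a *\<^sub>R T) u = a *\<^sub>R T u" for a u and T :: "'k \<times> 'l \<Rightarrow> 'k \<times> 'l"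
    by (simp add: scaleR_fun_def)
  then have lin\<sigma>: "linear \<sigma>"
    unfolding \<sigma>_def
    by (intro linearI) (simp_all add: parts_simps tensor_simps
        sum.distrib scaleR_sum_right algebra_simps)
  have lin_tl: "linear (\<lambda>A. A \<otimes> w)" for w :: 'l by (rule linearI) (simp_all add: tensor_simps)
  have \<sigma>\<tau>: "\<sigma> (tensor_rotation K1 K2 t) = t" if "t \<in> TS" for t
  proof (rule linear_eq_on_tensor_space[OF _ _ _ that])
    show "linear (\<lambda>t. \<sigma> (tensor_rotation K1 K2 t))"
      using linear_compose[OF linear_tensor_rotation lin\<sigma>] by (simp add: o_def)
    fix A w assume A: "A \<in> V" and w: "w \<in> W"
    have "\<sigma> (tensor_rotation K1 K2 (A \<otimes> w)) = (\<Sum>i<n. ((e i * g A (c i)) *\<^sub>R c i) \<otimes> w)"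
      by (simp add: \<sigma>_def tensor_rotation_pure A w mixed_rotation_def parts_simps p_j p_pure m_j cV form_simps tensor_simps del: scaleR_Pair)
    also have "\<dots> = A \<otimes> w"
      unfolding linear_sum[OF lin_tl, symmetric] cA[OF A] ..
    finally show "\<sigma> (tensor_rotation K1 K2 (A \<otimes> w)) = A \<otimes> w" .
  qed (rule linear_ident)
  have \<psi>\<phi>: "\<psi> (L2_to_so K1 K2 X) = X" if X: "X \<in> ?C" for X
  proof -
    obtain D t E where X: "X = (D, t, E)" "D \<in> Der_H2 K1" "t \<in> TS" "E \<in> carrier (so W (cnorm K2))"
      using X by (auto simp: L2_carrier)
    note D = Der_facts[OF X(2)] and E = so_pure_facts[OF X(4)]
    note off = tensor_rotation_offdiagonal[OF X(3)]
    have "on_space (H2 K1) (\<lambda>A. m (L2_to_so K1 K2 X (j A))) = D"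
    proof
      fix A
      show "on_space (H2 K1) (\<lambda>A. m (L2_to_so K1 K2 X (j A))) A = D A"
      proof (cases "A \<in> H2 K1")
        case True
        then obtain A' a where A: "A' \<in> V" "A = A' + a *\<^sub>R unit_mat K1"
          using H2_decompose[OF K1] by blast
        \<comment> \<open>The multiple of the unit matrix is invisible to both sides:
          \<open>D\<close> kills it, and so does \<open>j\<close>.\<close>
        have "D A = D A'"
        proof -
          have "D (unit_mat K1) = 0" using X(2) by (simp add: Der_H2_iff[OF K1])
          then show ?thesis
            unfolding A(2)
            using D(1)[OF in_H2[OF A(1)] subspace_scale[OF subspaces(3) unit_mat_H2[OF K1]]]
              D(2)[OF unit_mat_H2[OF K1]]
            by simp
        qed
        moreover have "j A = j A'" by (simp add: A(2) parts_simps j_unit)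
        ultimately show ?thesis using True
          by (simp add: on_space_def X(1) L2_to_so_def diagonal_rotation_def parts_simps off m_j A(1) D(3) p_j E(5)
              m_pure subspace_0[OF subspaces(2)])
      next
        case False
        then show ?thesis using endoD(3)[of D "H2 K1" A] X(2) by (simp add: Der_H2_def on_space_def)
      qed
    qed
    moreover have "\<sigma> (L2_to_so K1 K2 X) = t"
    proof -
      \<comment> \<open>A diagonal rotation keeps \<open>j (c i)\<close> in the image of
        \<open>j\<close>, where \<open>p\<close> vanishes.\<close>
      have "\<sigma> (diagonal_rotation K1 K2 D E) = 0"
        by (simp add: \<sigma>_def diagonal_rotation_def parts_simps p_j p_pure subspace_0[OF subspaces(2)] E(5) tensor_simps)
      then show ?thesis
        by (simp add: X(1) L2_to_so_def linear_add[OF lin\<sigma>] \<sigma>\<tau>[OF X(3)])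
    qed
    moreover have "on_space W (\<lambda>w. p (L2_to_so K1 K2 X (0, w))) = E"
    proof
      fix w
      show "on_space W (\<lambda>w. p (L2_to_so K1 K2 X (0, w))) w = E w"
        using E(3)[of w] endoD(3)[of E W w] X(4)
        by (auto simp: so_iff on_space_def X(1) L2_to_so_def diagonal_rotation_def parts_simps off p_j p_pure)
    qed
    ultimately show ?thesis by (simp add: \<psi>_def X(1))
  qed
  have \<psi>C: "\<psi> T \<in> ?C" and \<phi>\<psi>: "L2_to_so K1 K2 (\<psi> T) = T" if T: "T \<in> ?S" for T
  proof -
    have lT: "linear T" and skew: "P (T u) v = - P u (T v)" for u v
      using T unfolding so_sum_iff by blast+
    note T = linear_add[OF lT] linear_scale[OF lT] linear_0[OF lT]
    have \<sigma>: "\<sigma> T \<in> TS"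
      unfolding \<sigma>_def
      by (intro subspace_sum subspace_scale subspace_tensor_space tensor_in_space cV p_in)
    \<comment> \<open>By \<open>P_j\<close> skewness of \<open>T\<close> becomes skewness of the
      block, and the unit is killed because \<open>j\<close> kills it; this is the criterion of
      \<open>Der_H2_iff\<close>.\<close>
    have "on_space (H2 K1) (\<lambda>A. m (T (j A))) \<in> Der_H2 K1"
      unfolding Der_H2_iff[OF K1]
      using subspaces(3) in_H2 unit_mat_H2[OF K1] m_in skew[of "j _" "j _"]
      by (auto simp: endo_def linear_on_def on_space_def parts_simps T subspace_add subspace_scale j_unit P_j m_j)
    moreover have "on_space W (\<lambda>w. p (T (0, w))) \<in> carrier (so W (cnorm K2))"
    proof -
      have "p (T (0, x + y)) = p (T (0, x)) + p (T (0, y))" "p (T (0, a *\<^sub>R x)) = a *\<^sub>R p (T (0, x))" for x y a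
        using T(1)[of "(0, x)" "(0, y)"] T(2)[of a "(0, x)"] by (simp_all add: parts_simps)
      moreover have "polar (cnorm K2) (p (T (0, x))) y = - polar (cnorm K2) x (p (T (0, y)))"
        if "x \<in> W" "y \<in> W" for x y
        using skew[of "(0, x)" "(0, y)"] that by (simp add: P_pure)
      ultimately show ?thesis
        using subspaces(2) p_in
        by (auto simp: so_iff endo_def linear_on_def on_space_def subspace_add subspace_scale)
    qed
    ultimately show "\<psi> T \<in> ?C" using \<sigma> by (simp add: \<psi>_def L2_carrier)
    show "L2_to_so K1 K2 (\<psi> T) = T"
    proof
      fix u
      \<comment> \<open>Skewness determines the block from \<open>pure K2\<close> to
        \<open>H2' K1\<close> by the opposite one, so \<sigma>, which records only one of them,
        recovers both.\<close>
      have skew': "polar (cnorm K2) (p (T (j A))) (p u) = - g A (m (T (0, p u)))" for A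
        using skew[of "j A" "(0, p u)"] by (simp add: P_j P_pure p_in)
      have l0: "linear (\<lambda>A. (0::'k, p (T (j A))))"
        by (rule linearI) (simp_all add: parts_simps T)
      have "linear (\<lambda>S :: 'k \<times> 'l \<Rightarrow> 'k \<times> 'l. S u)"
        by (rule linearI) (simp_all add: scaleR_fun_def)
      from linear_compose[OF linear_tensor_rotation this]
      have lu: "linear (\<lambda>t. tensor_rotation K1 K2 t u)" by (simp add: o_def)
      have "tensor_rotation K1 K2 (\<sigma> T) u =
          (\<Sum>i<n. (e i / 2) *\<^sub>R mixed_rotation K1 K2 (c i) (p (T (j (c i)))) u)"
        by (simp add: \<sigma>_def linear_sum[OF lu] linear_scale[OF lu] tensor_rotation_pure cV p_in)
      \<comment> \<open>The factor 2 of the mixed rotation cancels the halves. The two sums are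
        frame expansions of \<open>m u\<close> and, through \<open>skew'\<close>, of
        \<open>m (T (0, p u))\<close>.\<close>
      also have "\<dots> = (\<Sum>i<n. (0, p (T (j ((e i * g (m u) (c i)) *\<^sub>R c i))))) +
          (\<Sum>i<n. j ((e i * g (m (T (0, p u))) (c i)) *\<^sub>R c i))"
        unfolding sum.distrib[symmetric]
        by (intro sum.cong) (simp_all add: mixed_rotation_def skew' parts_simps T algebra_simps
            spin_form_commute[OF K1, of "c _"])
      also have "\<dots> = (0, p (T (j (m u)))) + j (m (T (0, p u)))"
        unfolding linear_sum[OF l0, symmetric] linear_sum[OF linear_parts(1), symmetric]
          cA[OF m_in] ..
      \<comment> \<open>The four blocks are regrouped as \<open>T (j (m u))\<close> plus
        \<open>T (0, p u)\<close>, which \<open>parts_split\<close> and additivity assemble to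
        \<open>T u\<close>.\<close>
      finally have "L2_to_so K1 K2 (\<psi> T) u =
          (j (m (T (j (m u)))) + (0, p (T (j (m u))))) + (j (m (T (0, p u))) + (0, p (T (0, p u))))"
        by (simp add: \<psi>_def L2_to_so_def diagonal_rotation_def on_space_def m_in p_in in_H2 algebra_simps)
      also have "\<dots> = T u" by (simp only: parts_split flip: T(1))
      finally show "L2_to_so K1 K2 (\<psi> T) u = T u" .
    qed
  qed
  show ?thesis
    by (rule bij_betw_byWitness[where f' = \<psi>]) (use \<psi>\<phi> \<phi>\<psi> \<psi>C L2_to_so_in in auto)
qed

theorem L2_iso_so:
  assumes b: "orthonormal_frame (cnorm K1) s t b"
  shows "L2 K1 K2 \<cong>\<^sub>L so UNIV (sum_form K1 K2)"
  by (rule lie_isoI[OF lie_algebra_so[OF subspace_UNIV bilinear_P] subspace_L2 L2_closed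
        linear_L2_to_so bij_L2_to_so[OF b]])
    (simp_all add: L2_to_so_hom)

text \<open>With \<open>K1\<close> definite, its frame followed by that of \<open>K2\<close> still
  lists the positive vectors first, now \<open>n + s\<close> of them.\<close>

lemma sum_frame:
  assumes b: "orthonormal_frame (cnorm K1) n 0 b" and c: "orthonormal_frame (cnorm K2) s t c"
  shows "orthonormal_frame (sum_form K1 K2) (n + s) t (\<lambda>i. if i < n then (b i, 0) else (0, c (i - n)))"
proof -
  let ?d = "\<lambda>i. if i < n then (b i, 0) else (0, c (i - n))"
  have b1: "polar (cnorm K1) (b i) (b k) = (if i = k then 1 else 0)" if "i < n" "k < n" for i k
    using b that by (simp add: orthonormal_frame_def frame_sign_def)
  have c1: "polar (cnorm K2) (c i) (c k) = (if i = k then frame_sign s i else 0)"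
    if "i < s + t" "k < s + t" for i k
    using c that unfolding orthonormal_frame_def by blast
  have b2: "(\<Sum>i<n. polar (cnorm K1) x (b i) *\<^sub>R b i) = x" for x
    using b unfolding orthonormal_frame_def by (simp add: frame_sign_def)
  have c2: "(\<Sum>i<s + t. (frame_sign s i * polar (cnorm K2) y (c i)) *\<^sub>R c i) = y" for y
    using c unfolding orthonormal_frame_def by metis
  have "(\<Sum>i<n + s + t. (frame_sign (n + s) i * P v (?d i)) *\<^sub>R ?d i) = v" for v
  proof -
    let ?f = "\<lambda>i. (frame_sign (n + s) i * P v (?d i)) *\<^sub>R ?d i"
    have "(\<Sum>i<n + k. f i) = (\<Sum>i<n. f i) + (\<Sum>i<k. f (n + i))"
      for f :: "nat \<Rightarrow> 'k \<times> 'l" and k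
      by (induction k) (simp_all add: add.assoc)
    then have "(\<Sum>i<n + (s + t). ?f i) = (\<Sum>i<n. ?f i) + (\<Sum>i<s + t. ?f (n + i))" .
    also have "(\<Sum>i<n. ?f i) = (\<Sum>i<n. (polar (cnorm K1) (fst v) (b i) *\<^sub>R b i, 0))"
      by (intro sum.cong) (simp_all add: polar_sum calg_polar_simps[OF K2] frame_sign_def)
    also have "\<dots> = (fst v, 0)"
      by (simp add: sum_prod b2)
    \<comment> \<open>Shifting the index and the threshold of \<open>frame_sign\<close> by the same
      \<open>n\<close> leaves the sign unchanged.\<close>
    also have "(\<Sum>i<s + t. ?f (n + i)) =
        (\<Sum>i<s + t. (0, (frame_sign s i * polar (cnorm K2) (snd v) (c i)) *\<^sub>R c i))"
      by (intro sum.cong) (simp_all add: polar_sum calg_polar_simps[OF K1] frame_sign_def)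
    also have "\<dots> = (0, snd v)"
      by (simp add: sum_prod c2)
    finally show ?thesis by (simp add: add.assoc)
  qed
  then show ?thesis
    unfolding orthonormal_frame_def
    by (auto simp: polar_sum b1 c1 calg_polar_simps[OF K1] calg_polar_simps[OF K2] frame_sign_def)
qed

end

section \<open>Transport along isomorphisms of algebras\<close>

text \<open>\<open>calg_iso\<close> by itself does not assert that \<open>K\<close> is a composition
  algebra; the axioms are pulled back along the bijection, those of the product by
  injectivity.\<close>

lemma composition_algebra_iso:
  fixes K :: "'k::real_vector calg" and L :: "'l::real_vector calg"
  assumes iso: "calg_iso K L" and L: "composition_algebra L"
  shows "composition_algebra K"
proof -
  obtain f where f: "linear f" "bij f" "f (cone K) = cone L"
    "\<And>x y. f (cmult K x y) = cmult L (f x) (f y)" "\<And>x. cnorm L (f x) = cnorm K x"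
    using iso unfolding calg_iso_def by blast
  note lf = linear_add[OF f(1)] linear_scale[OF f(1)] linear_0[OF f(1)]
  have inj: "x = y" if "f x = f y" for x y using f(2) that by (auto simp: bij_def inj_def)
  have surj: "\<exists>x. y = f x" for y using f(2) by (auto simp: bij_def surj_def)
  have pol: "polar (cnorm K) x y = polar (cnorm L) (f x) (f y)" for x y
    by (simp add: polar_def lf flip: f(5))
  have "bilinear (cmult K)"
    unfolding bilinear_def
    by (intro conjI allI linearI; rule inj) (simp_all add: lf f calg_mult_simps[OF L])
  moreover have "cone K \<noteq> 0" using calg_one_nonzero[OF L] f(3) lf(3) by auto
  moreover have "cmult K (cone K) x = x" "cmult K x (cone K) = x" for x
    by (rule inj, simp add: f calg_one[OF L])+
  moreover have "quadratic_form (cnorm K)"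
    unfolding quadratic_form_def bilinear_def
    by (intro conjI allI linearI)
      (simp_all add: pol lf calg_polar_simps[OF L] calg_norm_scale[OF L] flip: f(5))
  moreover have "nondegenerate (cnorm K)"
    unfolding nondegenerate_def pol
    by (metis calg_nondegenerate[OF L] inj lf(3) surj)
  moreover have "cnorm K (cmult K x y) = cnorm K x * cnorm K y" for x y
    by (simp add: f(4) calg_norm_mult[OF L] flip: f(5))
  ultimately show ?thesis unfolding composition_algebra_def by blast
qed

lemma orthonormal_frame_iso:
  fixes K :: "'k::real_vector calg" and L :: "'l::real_vector calg"
  assumes iso: "calg_iso K L" and b: "orthonormal_frame (cnorm L) s t b"
  obtains c where "orthonormal_frame (cnorm K) s t c"
proof -
  obtain f where f: "linear f" "bij f" "\<And>x. cnorm L (f x) = cnorm K x"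
    using iso unfolding calg_iso_def by blast
  note lf = linear_add[OF f(1)] linear_scale[OF f(1)]
  have inj: "x = y" if "f x = f y" for x y using f(2) that by (auto simp: bij_def inj_def)
  have fi: "f (inv f y) = y" for y using f(2) by (simp add: bij_is_surj surj_f_inv_f)
  have pol: "polar (cnorm K) x y = polar (cnorm L) (f x) (f y)" for x y
    by (simp add: polar_def lf flip: f(3))
  have "orthonormal_frame (cnorm K) s t (inv f \<circ> b)"
    unfolding orthonormal_frame_def
  proof (intro conjI allI impI)
    show "v = (\<Sum>i<s + t. (frame_sign s i * polar (cnorm K) v ((inv f \<circ> b) i)) *\<^sub>R (inv f \<circ> b) i)" for v
      using b by (intro inj) (simp add: pol fi lf linear_sum[OF f(1)] orthonormal_frame_def)
  qed (use b in \<open>simp add: pol fi orthonormal_frame_def\<close>)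
  then show ?thesis by (rule that)
qed

lemma calg_iso_dim:
  fixes K :: "'k::real_vector calg" and L :: "'l::real_vector calg"
  assumes "calg_iso K L"
  shows "dim (UNIV :: 'k set) = dim (UNIV :: 'l set)"
proof -
  obtain f :: "'k \<Rightarrow> 'l" where f: "linear f" "bij f" using assms unfolding calg_iso_def by blast
  obtain B where B: "independent B" "span B = (UNIV :: 'k set)"
    by (metis basis_exists subset_UNIV subset_antisym)
  have "independent (f ` B)"
    using linear_independent_injective_image[OF f(1) B(1)] f(2) by (auto simp: bij_def inj_on_def)
  moreover have "span (f ` B) = UNIV"
    using linear_span_image[OF f(1), of B] B(2) f(2) by (simp add: bij_def)
  moreover have "card (f ` B) = card B"
    using f(2) by (intro card_image) (auto simp: bij_def inj_on_def)
  ultimately show ?thesis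
    using dim_eq_card[of B UNIV] dim_eq_card[of "f ` B" UNIV] B by simp
qed

text \<open>Bridges the concrete signatures 1, 2, 4 and 8 and the dimensions \<nu>1, \<nu>2 of the
  theorem: the length of the frame is restated as a dimension.\<close>

lemma definite_algebra_frame:
  fixes K :: "'k::real_vector calg" and L :: "'l::real_vector calg"
  assumes iso: "calg_iso K L" and L: "composition_algebra L" and sig: "has_signature (cnorm L) n 0"
  shows "composition_algebra K \<and> (\<exists>b. orthonormal_frame (cnorm K) (dim (UNIV :: 'k set)) 0 b)"
proof -
  have "dim (UNIV :: 'k set) = n"
    using calg_iso_dim[OF iso] has_signature_dim[OF sig] by simp
  moreover obtain b where "orthonormal_frame (cnorm L) n 0 b"
    using has_signature_frame[OF calg_quadratic_form[OF L] sig] .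
  ultimately show ?thesis
    using composition_algebra_iso[OF iso L] orthonormal_frame_iso[OF iso] by metis
qed

lemma division_algebra_frame:
  fixes K :: "'k::real_vector calg"
  assumes "calg_iso K real_alg \<or> calg_iso K complex_alg \<or>
    calg_iso K quaternion_alg \<or> calg_iso K octonion_alg"
  shows "composition_algebra K \<and> (\<exists>b. orthonormal_frame (cnorm K) (dim (UNIV :: 'k set)) 0 b)"
  using assms definite_algebra_frame[OF _ real_alg] definite_algebra_frame[OF _ complex_alg]
    definite_algebra_frame[OF _ quaternion_alg(1,2)] definite_algebra_frame[OF _ octonion_alg]
  by blast

theorem theorem4:
  fixes K1 :: "'a::real_vector calg" and K2 :: "'b::real_vector calg"
    and K2s :: "'c::real_vector calg" and \<nu>1 \<nu>2 :: nat
  assumes K1: "calg_iso K1 real_alg \<or> calg_iso K1 complex_alg \<or>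
               calg_iso K1 quaternion_alg \<or> calg_iso K1 octonion_alg"
    and K2: "calg_iso K2 real_alg \<or> calg_iso K2 complex_alg \<or>
             calg_iso K2 quaternion_alg \<or> calg_iso K2 octonion_alg"
    and \<nu>1: "\<nu>1 = dim (UNIV :: 'a set)" and \<nu>2: "\<nu>2 = dim (UNIV :: 'b set)"
  shows "(L2 K1 K2 \<cong>\<^sub>L so UNIV (sum_form K1 K2)) \<and>
         ((calg_iso K2 complex_alg \<or> calg_iso K2 quaternion_alg \<or> calg_iso K2 octonion_alg) \<longrightarrow>
          split_form_of K2s K2 \<longrightarrow>
          (L2 K1 K2s \<cong>\<^sub>L so_pq (\<nu>1 + \<nu>2 div 2) (\<nu>2 div 2)))"
proof (intro conjI impI)
  note C1 = division_algebra_frame[OF K1, THEN conjunct1]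
  obtain b where b: "orthonormal_frame (cnorm K1) \<nu>1 0 b"
    using division_algebra_frame[OF K1] \<nu>1 by blast
  show "L2 K1 K2 \<cong>\<^sub>L so UNIV (sum_form K1 K2)"
    by (rule L2_iso_so[OF C1 division_algebra_frame[OF K2, THEN conjunct1] b])
  assume "split_form_of K2s K2"
  then obtain p where C2: "composition_algebra K2s" and d: "dim (UNIV :: 'c set) = \<nu>2"
    and p: "has_signature (cnorm K2s) p p"
    unfolding split_form_of_def \<nu>2 by blast
  \<comment> \<open>The dimension of the split form is \<open>p + p\<close>, so the truncating
    division is exact.\<close>
  have "\<nu>2 div 2 = p" using has_signature_dim[OF p] d by simp
  moreover obtain c where "orthonormal_frame (cnorm K2s) p p c"
    using has_signature_frame[OF calg_quadratic_form[OF C2] p] .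
  \<comment> \<open>\<open>sum_frame\<close> with \<open>s = t = p\<close> gives a frame of
    signature \<open>(\<nu>1 + p, p)\<close> on \<open>K1 + K2s\<close>, whose coordinates identify
    the orthogonal algebra with \<open>so_pq\<close>.\<close>
  ultimately show "L2 K1 K2s \<cong>\<^sub>L so_pq (\<nu>1 + \<nu>2 div 2) (\<nu>2 div 2)"
    using lie_iso_trans[OF L2_iso_so[OF C1 C2 b] so_iso_so_pq[OF bilinear_P[OF C1 C2] sum_frame[OF C1 C2 b]]]
    by metis
qed

end
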